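(* Let $n\ge 1$ and $L$ be integers with $2^{n-1}<L\le 2^n$, and let $m,h,t,s$, $\mathbf{S}$ and $\mathbf{R}$ be as described in the context, where, in case $n=2m-1$, the set $\mathbf{T}$ is assumed to contain the strings of the PCR cycle of $(01)^{m-1}1$. Define a map on length-$n$ binary strings as follows: for $\alpha=a_1\cdots a_n$, let $x=\mathrm{PCR3}(\alpha)$ and $\beta=a_2\cdots a_n x$; if $\beta\notin\mathbf{S}$ replace $x$ by $1-x$; then, if $\beta\in\mathbf{R}$, replace $x$ by $1-x$ (once more); the image of $\alpha$ is $a_2\cdots a_n x$. Starting from $\alpha^{(0)}=0^{n-1}1$ and iterating this map, the resulting sequence of first symbols is a binary cut-down de Bruijn sequence of length $L$; that is, $\alpha^{(L)}=\alpha^{(0)}$ and the cyclic string formed by the first symbols of $\alpha^{(0)},\dots,\alpha^{(L-1)}$ has length $L$ and contains every binary string of length $n$ at most once as a cyclic substring.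
   Context: Binary strings of length $n$; the weight of a binary string is its number of 1s. The period of $\alpha=a_1\cdots a_n$ is the least $p$ with $\alpha=(a_1\cdots a_p)^{n/p}$. A necklace is a string that is lexicographically smallest among its rotations. The pure cycling register (PCR) partitions $\{0,1\}^n$ into rotation classes ("PCR cycles"). $\mathrm{PCR3}(a_1\cdots a_n)=1-a_1$ if $a_2a_3\cdots a_n1$ is a necklace, and $=a_1$ otherwise. Let $A(w)$ be the number of binary length-$n$ strings with weight $\le w$, and $C(w,p)$ the number with weight $w$ and period $\le p$. Let $m$ be the least weight with $A(m)\ge L$; $h$ the least period with $A(m-1)+C(m,h)\ge L$; $t$ the least integer with $A(m-1)+C(m,h-1)+th\ge L$; $s=A(m-1)+C(m,h-1)+ht-L$. Let $\mathbf{T}$ be the set of strings lying on some chosen $t$ PCR cycles of weight $m$ and period $h$, and $\mathbf{S}$ the set of all length-$n$ binary strings of weight $<m$, all of weight $m$ and period $<h$, together with $\mathbf{T}$. For $i\ge1$ define $\gamma_1=0^n$; for $i>1$ with $i\mid n$, $\gamma_i=(0^{i-1}1)^{n/i}$; for $i>1$ with $i\nmid n$, $\gamma_i=0^y1(0^{i-1}1)^{x}$ where $x=\lfloor n/i\rfloor$ and $y=(n \bmod i)-1$. Let $j=\lceil n/2\rceil$; set $\mathbf{R}=\{\gamma_s\}$ if $1\le s\le j$, $\mathbf{R}=\{\gamma_j,\gamma_{s-j}\}$ if $s>j$, and $\mathbf{R}=\emptyset$ if $s=0$. A binary cut-down de Bruijn sequence of length $L$ (order $n$) is a cyclic binary string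 of length $L$ in which every length-$n$ string appears at most once as a substring. *)

theory Defs
  imports Main "HOL-Library.List_Lexorder"
begin

text \<open>
  Binary strings are boolean lists, with \<open>False\<close> for the symbol 0 and \<open>True\<close> for the symbol 1.
  Since \<open>False < True\<close>, the order on \<^typ>\<open>bool list\<close> is the usual lexicographic order.
\<close>

definition binary_strings :: "nat \<Rightarrow> bool list set" where
  "binary_strings n = {\<alpha>. length \<alpha> = n}"

definition weight :: "bool list \<Rightarrow> nat" where
  "weight \<alpha> = count_list \<alpha> True"

definition string_power :: "bool list \<Rightarrow> nat \<Rightarrow> bool list" where
  "string_power u k = concat (replicate k u)"

definition period :: "bool list \<Rightarrow> nat" where
  "period \<alpha> = (LEAST p. 0 < p \<and> p dvd length \<alpha> \<and>
                        \<alpha> = string_power (take p \<alpha>) (length \<alpha> div p))"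

definition necklace :: "bool list \<Rightarrow> bool" where
  "necklace \<alpha> \<longleftrightarrow> (\<forall>k. \<alpha> \<le> rotate k \<alpha>)"

definition pcr_cycle :: "bool list \<Rightarrow> bool list set" where
  "pcr_cycle \<alpha> = {rotate k \<alpha> | k. True}"

definition pcr3 :: "bool list \<Rightarrow> bool" where
  "pcr3 \<alpha> = (if necklace (tl \<alpha> @ [True]) then \<not> hd \<alpha> else hd \<alpha>)"

definition num_weight_le :: "nat \<Rightarrow> nat \<Rightarrow> nat" where
  "num_weight_le n w = card {\<alpha> \<in> binary_strings n. weight \<alpha> \<le> w}"

definition num_weight_period_le :: "nat \<Rightarrow> nat \<Rightarrow> nat \<Rightarrow> nat" where
  "num_weight_period_le n w p = card {\<alpha> \<in> binary_strings n. weight \<alpha> = w \<and> period \<alpha> \<le> p}"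

text \<open>
  The parameters \<open>m\<close>, \<open>h\<close>, \<open>t\<close>, \<open>s\<close> are only used for \<open>2 ^ (n - 1) < L \<le> 2 ^ n\<close> with \<open>n \<ge> 1\<close>.
  Then \<open>m \<ge> 1\<close> (only one string has weight 0 and \<open>L \<ge> 2\<close>) and \<open>h \<ge> 1\<close> (there are fewer than \<open>L\<close>
  strings of weight below \<open>m\<close>), so the subtractions of 1 do not truncate; the subtraction in
  \<open>cut_s\<close> does not truncate by the choice of \<open>t\<close>. In \<open>cut_h\<close> the minimum is automatically attained
  at a period of some string of weight \<open>m\<close>, as the count changes only at such values.
\<close>

definition cut_m :: "nat \<Rightarrow> nat \<Rightarrow> nat" where
  "cut_m n L = (LEAST w. num_weight_le n w \<ge> L)"

definition cut_h :: "nat \<Rightarrow> nat \<Rightarrow> nat" where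
  "cut_h n L = (let m = cut_m n L in
     LEAST p. num_weight_le n (m - 1) + num_weight_period_le n m p \<ge> L)"

definition cut_t :: "nat \<Rightarrow> nat \<Rightarrow> nat" where
  "cut_t n L = (let m = cut_m n L; h = cut_h n L in
     LEAST t. num_weight_le n (m - 1) + num_weight_period_le n m (h - 1) + t * h \<ge> L)"

definition cut_s :: "nat \<Rightarrow> nat \<Rightarrow> nat" where
  "cut_s n L = (let m = cut_m n L; h = cut_h n L; t = cut_t n L in
     num_weight_le n (m - 1) + num_weight_period_le n m (h - 1) + h * t - L)"

definition cut_S :: "nat \<Rightarrow> nat \<Rightarrow> nat \<Rightarrow> bool list set \<Rightarrow> bool list set" where
  "cut_S n m h T =
     {\<alpha> \<in> binary_strings n. weight \<alpha> < m} \<union>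
     {\<alpha> \<in> binary_strings n. weight \<alpha> = m \<and> period \<alpha> < h} \<union> T"

definition gamma_string :: "nat \<Rightarrow> nat \<Rightarrow> bool list" where
  "gamma_string n i =
     (if i = 1 then replicate n False
      else if i dvd n then string_power (replicate (i - 1) False @ [True]) (n div i)
      else replicate (n mod i - 1) False @ [True] @
           string_power (replicate (i - 1) False @ [True]) (n div i))"

text \<open>Here \<open>(n + 1) div 2\<close> is the ceiling of \<open>n / 2\<close>.\<close>

definition cut_R :: "nat \<Rightarrow> nat \<Rightarrow> bool list set" where
  "cut_R n s =
     (let j = (n + 1) div 2 in
      if s = 0 then {}
      else if s \<le> j then {gamma_string n s}
      else {gamma_string n j, gamma_string n (s - j)})"

text \<open>Both membership tests concern the same \<open>\<beta>\<close>, formed with the original value of \<open>x\<close>.\<close>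

definition cut_step :: "bool list set \<Rightarrow> bool list set \<Rightarrow> bool list \<Rightarrow> bool list" where
  "cut_step S R \<alpha> =
     (let x = pcr3 \<alpha>;
          \<beta> = tl \<alpha> @ [x];
          x' = (if \<beta> \<notin> S then \<not> x else x);
          x'' = (if \<beta> \<in> R then \<not> x' else x')
      in tl \<alpha> @ [x''])"

definition cyclic_window :: "nat \<Rightarrow> bool list \<Rightarrow> nat \<Rightarrow> bool list" where
  "cyclic_window n u i = map (\<lambda>k. u ! ((i + k) mod length u)) [0..<n]"

definition cutdown_de_bruijn :: "nat \<Rightarrow> nat \<Rightarrow> bool list \<Rightarrow> bool" where
  "cutdown_de_bruijn n L u \<longleftrightarrow>
     length u = L \<and>
     (\<forall>w \<in> binary_strings n. card {i. i < L \<and> cyclic_window n u i = w} \<le> 1)"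

end

theory Submission
  imports Defs
begin

text \<open>
  Toggling the final 1 of a nonzero necklace lowers its weight by one, so the PCR cycles form a tree
  rooted at the cycle of \<open>0\<^sup>n\<close>, and PCR3 joins every cycle to its parent. As \<open>S\<close> is a union of cycles
  closed under taking parents, PCR3 restricted to \<open>S\<close> (a toggle whenever \<open>S\<close> would be left) is a
  single cycle through all of \<open>S\<close>, which has \<open>L + s\<close> elements.

  On this cycle the \<open>i\<close> strings starting with \<open>\<gamma>\<^sub>i\<close> are followed by \<open>\<gamma>\<^sub>i\<close> with its last bit toggled,
  provided \<open>i \<le> \<lceil>n/2\<rceil>\<close>. Hence toggling the last bit of \<open>\<gamma>\<^sub>i\<close> on arrival cuts exactly \<open>i\<close> strings out
  of the cycle. One cut (\<open>i = s\<close>) or two disjoint cuts (\<open>i = \<lceil>n/2\<rceil>\<close> and \<open>i = s - \<lceil>n/2\<rceil>\<close>) leave a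
  cycle of length \<open>L\<close>.
\<close>

subsection \<open>Cycles of a map\<close>

text \<open>The first \<open>card A\<close> iterates of \<open>z\<close> fill a set of that size, so
  they are automatically distinct; \<open>A\<close> is a single orbit, numbered from
  \<open>z\<close>.\<close>

definition is_cycle :: "('a \<Rightarrow> 'a) \<Rightarrow> 'a \<Rightarrow> 'a set \<Rightarrow> bool" where
  "is_cycle g z A \<longleftrightarrow> finite A \<and> A \<noteq> {} \<and> (g ^^ card A) z = z
     \<and> (\<lambda>k. (g ^^ k) z) ` {..<card A} = A"

lemma is_cycle_inj:
  assumes "is_cycle g z A"
  shows "inj_on (\<lambda>k. (g ^^ k) z) {..<card A}"
proof (rule eq_card_imp_inj_on)
  have "(\<lambda>k. (g ^^ k) z) ` {..<card A} = A" using assms unfolding is_cycle_def by blast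
  then show "card ((\<lambda>k. (g ^^ k) z) ` {..<card A}) = card {..<card A}"
    by (simp only: card_lessThan)
qed simp

text \<open>A repetition before the first return time would yield an earlier return, so the orbit
  has exactly as many points as that time.\<close>

lemma is_cycle_orbit:
  assumes "\<exists>k>0. (g ^^ k) z = z"
  shows "is_cycle g z (range (\<lambda>k. (g ^^ k) z))" (is ?A)
    and "card (range (\<lambda>k. (g ^^ k) z)) = (LEAST k. 0 < k \<and> (g ^^ k) z = z)" (is ?B)
proof -
  define K where "K = (LEAST k. 0 < k \<and> (g ^^ k) z = z)"
  have K: "0 < K" "(g ^^ K) z = z"
    using LeastI_ex[of "\<lambda>k. 0 < k \<and> (g ^^ k) z = z"] assms unfolding K_def by auto
  have least: "(g ^^ k) z \<noteq> z" if "0 < k" "k < K" for k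
    using not_less_Least[of k "\<lambda>k. 0 < k \<and> (g ^^ k) z = z"] that unfolding K_def by auto
  have ne: "(g ^^ i) z \<noteq> (g ^^ j) z" if "i < j" "j < K" for i j
  proof
    assume eq: "(g ^^ i) z = (g ^^ j) z"
    have "(g ^^ (K - j + i)) z = (g ^^ (K - j)) ((g ^^ j) z)"
      by (simp add: funpow_add eq)
    also have "\<dots> = (g ^^ (K - j + j)) z"
      by (simp only: funpow_add o_apply)
    also have "\<dots> = z" using K that by simp
    finally have "(g ^^ (K - j + i)) z = z" .
    moreover have "0 < K - j + i" "K - j + i < K" using that by linarith+
    ultimately show False using least[of "K - j + i"] by simp
  qed
  have inj: "inj_on (\<lambda>k. (g ^^ k) z) {..<K}"
    by (rule linorder_inj_onI) (use ne in auto)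
  have img: "range (\<lambda>k. (g ^^ k) z) = (\<lambda>k. (g ^^ k) z) ` {..<K}"
  proof (intro equalityI subsetI)
    fix x assume "x \<in> range (\<lambda>k. (g ^^ k) z)"
    then obtain k where "x = (g ^^ k) z" by blast
    then have "x = (g ^^ (k mod K)) z" using funpow_mod_eq[OF K(2)] by simp
    then show "x \<in> (\<lambda>k. (g ^^ k) z) ` {..<K}" using K by simp
  qed auto
  have card: "card (range (\<lambda>k. (g ^^ k) z)) = K"
    using card_image[OF inj] img by simp
  show ?B using card K_def by simp
  show ?A unfolding is_cycle_def card using img K by auto
qed

text \<open>Number the cycle from \<open>z\<close>, with \<open>\<gamma>\<close> at position
  \<open>p\<close>. The segment of length \<open>s\<close> from \<open>\<gamma>\<close> never meets
  \<open>z\<close>, so it occupies \<open>{p..<p + s}\<close> without wrapping around, and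
  \<open>f\<close> jumps from position \<open>p - 1\<close> directly to
  \<open>p + s\<close>.\<close>

lemma is_cycle_cut:
  assumes cyc: "is_cycle g z A" and \<gamma>: "\<gamma> \<in> A" and s: "0 < s"
    and avoid: "\<And>k. k < s \<Longrightarrow> (g ^^ k) \<gamma> \<noteq> z"
    and f: "\<And>x. x \<in> A \<Longrightarrow> f x = (if g x = \<gamma> then (g ^^ s) \<gamma> else g x)"
  shows "is_cycle f z (A - (\<lambda>k. (g ^^ k) \<gamma>) ` {..<s})" (is "is_cycle f z ?B")
    and "card (A - (\<lambda>k. (g ^^ k) \<gamma>) ` {..<s}) = card A - s"
proof -
  define K where "K = card A"
  let ?b = "\<lambda>k. (g ^^ k) z"
  have K: "?b K = z" "?b ` {..<K} = A" and inj: "inj_on ?b {..<K}"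
    using cyc is_cycle_inj[OF cyc] unfolding is_cycle_def K_def by auto
  obtain p where p: "p < K" "?b p = \<gamma>" using \<gamma> K by auto
  have "p \<noteq> 0" using avoid[OF s] p by (cases p) auto
  have shift: "(g ^^ k) \<gamma> = ?b (p + k)" for k
    using p(2) by (metis add.commute comp_apply funpow_add)
  have ps: "p + s \<le> K"
  proof (rule ccontr)
    assume "\<not> p + s \<le> K"
    then have "K - p < s" using p(1) by simp
    moreover have "(g ^^ (K - p)) \<gamma> = z" using shift p K by simp
    ultimately show False using avoid by blast
  qed
  \<comment> \<open>\<open>e k\<close> is the position on the \<open>g\<close>-cycle of the
    \<open>k\<close>-th iterate of \<open>f\<close>. The end \<open>k = K - s\<close> is included
    below because \<open>e (K - s) = K\<close> shows that the shortened cycle closes.\<close>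
  define e where "e k = (if k < p then k else k + s)" for k
  have fe: "(f ^^ k) z = ?b (e k)" if "k \<le> K - s" for k
    using that
  proof (induction k)
    case 0
    then show ?case using \<open>p \<noteq> 0\<close> by (simp add: e_def)
  next
    case (Suc k)
    have ek: "e k < K" using Suc.prems ps by (auto simp: e_def)
    have "?b (e k) \<in> A" using K ek by auto
    then have "f (?b (e k)) = (if ?b (Suc (e k)) = \<gamma> then ?b (p + s) else ?b (Suc (e k)))"
      using f shift[of s] by simp
    moreover have "?b (Suc (e k)) = \<gamma> \<longleftrightarrow> Suc k = p"
    proof (cases "Suc (e k) < K")
      case True
      then have "?b (Suc (e k)) = ?b p \<longleftrightarrow> Suc (e k) = p"
        using inj_on_eq_iff[OF inj] p(1) by (metis lessThan_iff)
      then show ?thesis using p(2) by (auto simp: e_def)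
    next
      \<comment> \<open>Here the next position is \<open>K\<close>, which is \<open>z\<close> again
        and hence not \<open>\<gamma>\<close>.\<close>
      case False
      then have "Suc (e k) = K" using ek by simp
      then have "?b (Suc (e k)) \<noteq> \<gamma>" using K avoid[OF s] by auto
      moreover have "Suc k \<noteq> p" using \<open>Suc (e k) = K\<close> p by (auto simp: e_def)
      ultimately show ?thesis by blast
    qed
    moreover have "(f ^^ Suc k) z = f (?b (e k))" using Suc by simp
    ultimately have "(f ^^ Suc k) z = (if Suc k = p then ?b (p + s) else ?b (Suc (e k)))"
      by simp
    also have "\<dots> = ?b (e (Suc k))" by (auto simp: e_def)
    finally show ?case .
  qed
  have seg: "(\<lambda>k. (g ^^ k) \<gamma>) ` {..<s} = ?b ` {p..<p + s}"
  proof -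
    have "{p..<p + s} = (+) p ` {..<s}"
      using image_add_atLeastLessThan[of p 0 s] by (simp add: lessThan_atLeast0 add.commute)
    then show ?thesis by (simp only: image_image shift)
  qed
  have e_img: "e ` {..<K - s} = {..<K} - {p..<p + s}"
  proof (intro equalityI subsetI)
    fix x assume x: "x \<in> {..<K} - {p..<p + s}"
    show "x \<in> e ` {..<K - s}"
    proof (cases "x < p")
      case True
      then show ?thesis using ps by (intro image_eqI[of _ _ x]) (auto simp: e_def)
    next
      case False
      then show ?thesis using x by (intro image_eqI[of _ _ "x - s"]) (auto simp: e_def)
    qed
  qed (use ps in \<open>auto simp: e_def split: if_splits\<close>)
  have B: "?B = ?b ` ({..<K} - {p..<p + s})"
    unfolding seg K(2)[symmetric]
    by (rule inj_on_image_set_diff[symmetric, OF inj]) (use ps in auto)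
  have "card ?B = card ({..<K} - {p..<p + s})"
    unfolding B by (rule card_image) (rule inj_on_subset[OF inj], auto)
  also have "\<dots> = K - s"
    using ps by (subst card_Diff_subset) auto
  finally have card: "card ?B = K - s" .
  then show "card ?B = card A - s" by (simp add: K_def)
  have img: "(\<lambda>k. (f ^^ k) z) ` {..<K - s} = ?B"
  proof -
    have "(\<lambda>k. (f ^^ k) z) ` {..<K - s} = ?b ` e ` {..<K - s}"
      unfolding image_image by (rule image_cong) (use fe in auto)
    then show ?thesis unfolding e_img B .
  qed
  have "e (K - s) = K" using ps by (auto simp: e_def)
  then have ret: "(f ^^ (K - s)) z = z" using fe[of "K - s"] K by simp
  have "K - s > 0" using ps \<open>p \<noteq> 0\<close> by simp
  then have "(\<lambda>k. (f ^^ k) z) ` {..<K - s} \<noteq> {}" by (simp add: lessThan_empty_iff)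
  then have "?B \<noteq> {}" unfolding img .
  moreover have "finite ?B" using cyc by (simp add: is_cycle_def)
  ultimately show "is_cycle f z ?B" unfolding is_cycle_def card using img ret by (intro conjI) assumption+
qed

subsection \<open>Periods and rotation\<close>

lemma length_string_power [simp]: "length (string_power u k) = k * length u"
  by (simp add: string_power_def length_concat sum_list_replicate)

lemma string_power_0 [simp]: "string_power u 0 = []"
  by (simp add: string_power_def)

lemma string_power_Suc [simp]: "string_power u (Suc k) = u @ string_power u k"
  by (simp add: string_power_def)

lemma nth_string_power:
  "i < k * length u \<Longrightarrow> string_power u k ! i = u ! (i mod length u)"
proof (induction k arbitrary: i)
  case (Suc k)
  show ?case
  proof (cases "i < length u")
    case False
    then show ?thesis using Suc.IH[of "i - length u"] Suc.prems
      by (simp add: nth_append le_mod_geq)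
  qed (simp add: nth_append)
qed simp

text \<open>Invariance under rotation by \<open>p\<close> makes \<open>u ! i\<close> depend only on
  \<open>i mod p\<close>. Conversely, as \<open>p\<close> divides the length, reducing an index
  modulo the length preserves its residue modulo \<open>p\<close>.\<close>

lemma rotate_eq_self_iff_string_power:
  assumes "0 < p" and "p dvd length u"
  shows "rotate p u = u \<longleftrightarrow> u = string_power (take p u) (length u div p)"
proof
  let ?n = "length u"
  assume rot: "rotate p u = u"
  have mod: "u ! i = u ! (i mod p)" if "i < ?n" for i
    using that
  proof (induction i rule: less_induct)
    case (less i)
    show ?case
    proof (cases "i < p")
      case False
      then have "u ! (i - p) = rotate p u ! (i - p)" using rot by simp
      also have "\<dots> = u ! i" using less.prems False by (simp add: nth_rotate)
      finally show ?thesis using less.IH[of "i - p"] less.prems False assms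
        by (simp add: le_mod_geq)
    qed simp
  qed
  show "u = string_power (take p u) (?n div p)"
  proof (rule nth_equalityI)
    show "?n = length (string_power (take p u) (?n div p))"
      using assms by (cases "?n = 0") (auto simp: min_def dest: dvd_imp_le)
  next
    fix i assume i: "i < ?n"
    then have "p \<le> ?n" using assms by (auto dest: dvd_imp_le)
    then show "u ! i = string_power (take p u) (?n div p) ! i"
      using i assms by (subst nth_string_power) (simp_all add: min_def mod[symmetric])
  qed
next
  let ?n = "length u"
  assume eq: "u = string_power (take p u) (?n div p)"
  show "rotate p u = u"
  proof (rule nth_equalityI)
    fix i assume "i < length (rotate p u)"
    then have i: "i < ?n" by simp
    then have "p \<le> ?n" using assms by (auto dest: dvd_imp_le)
    have mod: "u ! k = u ! (k mod p)" if "k < ?n" for k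
    proof -
      have "u ! k = string_power (take p u) (?n div p) ! k" by (rule arg_cong[OF eq])
      also have "\<dots> = take p u ! (k mod p)"
        using that assms \<open>p \<le> ?n\<close> by (subst nth_string_power) (auto simp: min_def)
      finally show ?thesis using assms by simp
    qed
    have "rotate p u ! i = u ! ((p + i) mod ?n)" using i by (simp add: nth_rotate)
    also have "\<dots> = u ! ((p + i) mod ?n mod p)" using i by (intro mod mod_less_divisor) linarith
    also have "(p + i) mod ?n mod p = i mod p" using assms by (simp add: mod_mod_cancel)
    also have "u ! (i mod p) = u ! i" using mod[OF i] by simp
    finally show "rotate p u ! i = u ! i" .
  qed simp
qed

text \<open>Divisibility is automatic: the length is itself a return time, so its remainder modulo
  the least one must vanish. This makes the period the orbit size of rotation.\<close>

lemma period_eq_least_return: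
  assumes "u \<noteq> []"
  shows "period u = (LEAST k. 0 < k \<and> (rotate1 ^^ k) u = u)"
proof -
  let ?P = "\<lambda>k. 0 < k \<and> (rotate1 ^^ k) u = u"
  have n: "?P (length u)" using assms by (simp flip: rotate_def)
  define p where "p = (LEAST k. ?P k)"
  have p: "0 < p" "(rotate1 ^^ p) u = u"
    using LeastI[of ?P, OF n] unfolding p_def by auto
  have "(rotate1 ^^ (length u mod p)) u = u"
    using funpow_mod_eq[OF p(2)] n by simp
  then have "length u mod p = 0"
    using not_less_Least[of "length u mod p" ?P] p(1) unfolding p_def by force
  then have dvd: "p dvd length u" by auto
  show ?thesis
    unfolding period_def
  proof (rule Least_equality)
    show "0 < (LEAST k. ?P k) \<and> (LEAST k. ?P k) dvd length u \<and>
      u = string_power (take (LEAST k. ?P k) u) (length u div (LEAST k. ?P k))"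
      using p dvd rotate_eq_self_iff_string_power[of p u]
      unfolding p_def[symmetric] rotate_def by blast
  next
    fix q assume "0 < q \<and> q dvd length u \<and> u = string_power (take q u) (length u div q)"
    then have "?P q" using rotate_eq_self_iff_string_power[of q u] by (simp add: rotate_def)
    then show "(LEAST k. ?P k) \<le> q" by (rule Least_le)
  qed
qed

lemma pcr_cycle_range: "pcr_cycle u = range (\<lambda>k. (rotate1 ^^ k) u)"
  by (auto simp: pcr_cycle_def rotate_def)

lemma rotate1_returns: "u \<noteq> [] \<Longrightarrow> \<exists>k>0. (rotate1 ^^ k) u = u"
  by (rule exI[of _ "length u"]) (simp flip: rotate_def)

lemma card_pcr_cycle:
  assumes "u \<noteq> []"
  shows "card (pcr_cycle u) = period u"
  unfolding pcr_cycle_range period_eq_least_return[OF assms]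
  by (rule is_cycle_orbit(2)[OF rotate1_returns[OF assms]])

lemma period_pos:
  assumes "u \<noteq> []"
  shows "0 < period u"
  using LeastI_ex[OF rotate1_returns[OF assms]] unfolding period_eq_least_return[OF assms] by blast

lemma period_le_length:
  assumes "u \<noteq> []"
  shows "period u \<le> length u"
  unfolding period_eq_least_return[OF assms]
  by (rule Least_le) (use assms in \<open>simp flip: rotate_def\<close>)

lemma rotate_inverse: "\<exists>l. rotate l (rotate k u) = u"
proof (cases "u = []")
  case False
  have "rotate (length u - k mod length u) (rotate (k mod length u) u) = u"
    using False by (simp add: rotate_rotate del: rotate_conv_mod)
  then show ?thesis using rotate_conv_mod[of k u] by auto
qed simp

lemma pcr_cycle_rotate: "pcr_cycle (rotate k u) = pcr_cycle u"
proof -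
  obtain l where "rotate l (rotate k u) = u" using rotate_inverse by blast
  then show ?thesis
    unfolding pcr_cycle_def by (auto simp: rotate_rotate) (metis rotate_rotate)
qed

lemma period_rotate: "period (rotate k u) = period u"
proof (cases "u = []")
  case False
  then have "rotate k u \<noteq> []" by simp
  then have "period (rotate k u) = card (pcr_cycle u)"
    using card_pcr_cycle[of "rotate k u"] pcr_cycle_rotate[of k u] by simp
  then show ?thesis using card_pcr_cycle[OF False] by simp
qed simp

subsection \<open>The single cycle through a rotation-closed set\<close>

lemma weight_Nil [simp]: "weight [] = 0"
  by (simp add: weight_def)

lemma weight_Cons [simp]: "weight (b # u) = (if b then Suc (weight u) else weight u)"
  by (simp add: weight_def)

lemma weight_append [simp]: "weight (u @ v) = weight u + weight v"
  by (simp add: weight_def)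

lemma weight_replicate_False [simp]: "weight (replicate k False) = 0"
  by (induction k) auto

lemma weight_rotate1 [simp]: "weight (rotate1 u) = weight u"
  by (cases u) auto

lemma weight_rotate [simp]: "weight (rotate k u) = weight u"
  by (induction k) auto

lemma weight_le_length: "weight u \<le> length u"
  by (simp add: weight_def count_le_length)

lemma weight_eq_0D: "weight u = 0 \<Longrightarrow> u = replicate (length u) False"
  by (induction u) (auto split: if_splits)

section \<open>Necklaces as representatives of rotation classes\<close>

lemma necklace_unique:
  assumes "necklace u" and "necklace (rotate k u)"
  shows "rotate k u = u"
proof -
  obtain l where l: "rotate l (rotate k u) = u" using rotate_inverse by blast
  have "u \<le> rotate k u" using assms(1) unfolding necklace_def by blast
  moreover have "rotate k u \<le> rotate l (rotate k u)" using assms(2) unfolding necklace_def by blast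
  ultimately show ?thesis using l by simp
qed

lemma ex_necklace_rotate:
  assumes "u \<noteq> []"
  shows "\<exists>k. necklace (rotate k u)"
proof -
  have fin: "finite (pcr_cycle u)"
    using is_cycle_orbit(1)[OF rotate1_returns[OF assms]]
    unfolding is_cycle_def pcr_cycle_range by blast
  have "u \<in> pcr_cycle u" unfolding pcr_cycle_range by (rule range_eqI[of _ _ 0]) simp
  then have "Min (pcr_cycle u) \<in> pcr_cycle u" using fin by (intro Min_in) auto
  then obtain k where k: "Min (pcr_cycle u) = rotate k u" unfolding pcr_cycle_def by blast
  have "necklace (rotate k u)"
    unfolding necklace_def
  proof
    fix l
    have "rotate l (rotate k u) \<in> pcr_cycle u" unfolding pcr_cycle_def rotate_rotate by blast
    then show "rotate k u \<le> rotate l (rotate k u)" using k fin by (metis Min_le)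
  qed
  then show ?thesis by blast
qed

lemma snoc_le_Cons_False: "v @ [False] \<le> False # v \<Longrightarrow> weight v = 0"
  by (induction v) auto

text \<open>Rotating a trailing 0 to the front gives a smaller string unless all symbols are
  0.\<close>

lemma necklace_last:
  assumes "necklace u" and "weight u \<noteq> 0"
  shows "\<exists>v. u = v @ [True]"
proof -
  have "u \<noteq> []" using assms by auto
  then obtain v b where u: "u = v @ [b]" by (metis rev_exhaust)
  have "b"
  proof (rule ccontr)
    assume "\<not> b"
    then have "rotate (length v) u = False # v" using u by (simp add: rotate_append)
    then have "v @ [False] \<le> False # v" using assms(1) u \<open>\<not> b\<close> unfolding necklace_def by metis
    then show False using snoc_le_Cons_False assms(2) u \<open>\<not> b\<close> by fastforce
  qed
  then show ?thesis using u by simp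
qed

text \<open>Some rotation is a necklace, it ends in 1, and this is its only 1.\<close>

lemma necklace_single_one: "necklace (replicate k False @ [True])"
proof -
  let ?z = "replicate k False @ [True]"
  obtain l where l: "necklace (rotate l ?z)" using ex_necklace_rotate[of ?z] by blast
  obtain v where v: "rotate l ?z = v @ [True]" using necklace_last[OF l] by auto
  have "weight (v @ [True]) = 1" using v by (metis One_nat_def weight_append weight_rotate weight_replicate_False add_0 weight_Cons weight_Nil)
  then have "weight v = 0" by simp
  moreover have "length v = k" using arg_cong[OF v, of length] by simp
  ultimately show ?thesis using weight_eq_0D[of v] l v by simp
qed

definition flip_last :: "bool list \<Rightarrow> bool list" where
  "flip_last u = butlast u @ [\<not> last u]"

lemma flip_last_snoc [simp]: "flip_last (v @ [b]) = v @ [\<not> b]"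
  by (simp add: flip_last_def)

definition reaches :: "('a \<Rightarrow> 'a) \<Rightarrow> 'a \<Rightarrow> 'a \<Rightarrow> bool" where
  "reaches g x y \<longleftrightarrow> (\<exists>k. (g ^^ k) x = y)"

lemma reaches_refl: "reaches g x x"
  unfolding reaches_def by (rule exI[of _ 0]) simp

lemma reaches_step: "reaches g x (g x)"
  unfolding reaches_def by (rule exI[of _ 1]) simp

lemma reaches_trans:
  assumes "reaches g x y" and "reaches g y w"
  shows "reaches g x w"
proof -
  obtain k l where "(g ^^ k) x = y" "(g ^^ l) y = w" using assms unfolding reaches_def by blast
  then have "(g ^^ (l + k)) x = w" by (simp add: funpow_add)
  then show ?thesis unfolding reaches_def by blast
qed

text \<open>What the cycle argument uses of \<open>S\<close>: it lies between weight below
  \<open>m\<close> and weight at most \<open>m\<close> and is closed under rotation, hence contains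
  the parent of each of its cycles. \<open>S_single_one\<close> supplies the starting string also
  for \<open>m = 1\<close>, where \<open>S_low\<close> yields only the zero string.\<close>

locale weight_truncation =
  fixes n m :: nat and S :: "bool list set"
  assumes n_pos: "1 \<le> n"
    and S_length: "\<alpha> \<in> S \<Longrightarrow> length \<alpha> = n"
    and S_weight: "\<alpha> \<in> S \<Longrightarrow> weight \<alpha> \<le> m"
    and S_low: "length \<alpha> = n \<Longrightarrow> weight \<alpha> < m \<Longrightarrow> \<alpha> \<in> S"
    and S_rotate1: "\<alpha> \<in> S \<Longrightarrow> rotate1 \<alpha> \<in> S"
    and S_single_one: "replicate (n - 1) False @ [True] \<in> S"
begin

abbreviation "step \<equiv> cut_step S {}"
abbreviation "root \<equiv> replicate n False"
abbreviation "start \<equiv> replicate (n - 1) False @ [True]"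

lemma S_Cons:
  assumes "\<alpha> \<in> S"
  obtains x v where "\<alpha> = x # v" and "length v = n - 1" and "v @ [x] \<in> S"
  using S_length[OF assms] n_pos S_rotate1[OF assms] by (cases \<alpha>) auto

lemma S_rotate: "\<alpha> \<in> S \<Longrightarrow> rotate k \<alpha> \<in> S"
  by (induction k) (auto simp: S_rotate1)

lemma S_parent:
  assumes "v @ [True] \<in> S"
  shows "v @ [False] \<in> S" and "False # v \<in> S"
  using S_length[OF assms] S_weight[OF assms] by (auto intro: S_low)

text \<open>First of the four cases of the uncut map on \<open>x # v\<close>; they are told apart by
  whether \<open>v @ [True]\<close> is a necklace, which bit is shifted out, and whether
  \<open>S\<close> would be left.\<close>

lemma step_rotate:
  assumes "x # v \<in> S" and "\<not> necklace (v @ [True])"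
  shows "step (x # v) = v @ [x]"
  using assms S_rotate1[OF assms(1)] by (simp add: cut_step_def pcr3_def Let_def)

lemma step_exit:
  assumes "True # v \<in> S" and "necklace (v @ [True])"
  shows "step (True # v) = v @ [False]"
  using assms S_rotate1[OF assms(1)] S_parent(1)[of v] by (simp add: cut_step_def pcr3_def Let_def)

lemma step_enter:
  assumes "v @ [True] \<in> S" and "necklace (v @ [True])"
  shows "step (False # v) = v @ [True]"
  using assms by (simp add: cut_step_def pcr3_def Let_def)

text \<open>PCR3 would enter a child cycle outside \<open>S\<close>; the toggle for leaving
  \<open>S\<close> cancels this, so the string is merely rotated.\<close>

lemma step_skip:
  assumes "v @ [True] \<notin> S" and "necklace (v @ [True])"
  shows "step (False # v) = v @ [False]"
  using assms by (simp add: cut_step_def pcr3_def Let_def)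

lemma step_in_S:
  assumes "\<alpha> \<in> S"
  shows "step \<alpha> \<in> S"
proof -
  obtain x v where v: "\<alpha> = x # v" "v @ [x] \<in> S" using S_Cons[OF assms] by metis
  show ?thesis
  proof (cases "necklace (v @ [True])")
    case True
    then show ?thesis
      using v assms step_exit[of v] step_enter[of v] step_skip[of v] S_parent(1)[of v]
      by (cases x; cases "v @ [True] \<in> S") auto
  next
    case False
    then show ?thesis using step_rotate[of x v] v assms by simp
  qed
qed

text \<open>
  Having entered a PCR cycle at its necklace, the orbit visits the whole cycle before it leaves to
  the parent. Each detour into a child cycle returns to where plain rotation would have led, by
  induction on the weight counted downwards.
\<close>

lemma necklace_traverses:
  assumes "v @ [True] \<in> S" and "necklace (v @ [True])"
  shows "(\<forall>k. reaches step (v @ [True]) (rotate k (v @ [True])))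
    \<and> reaches step (v @ [True]) (v @ [False])"
  using assms
proof (induction "n - weight (v @ [True])" arbitrary: v rule: less_induct)
  case less
  let ?N = "v @ [True]"
  \<comment> \<open>Applied to a rotation of \<open>?N\<close>, the second alternative means a
    return to \<open>?N\<close> itself, since a class has only one necklace.\<close>
  have rot: "reaches step \<alpha> (rotate1 \<alpha>) \<or> necklace (rotate1 \<alpha>)"
    if \<alpha>: "\<alpha> \<in> S" and wt: "weight \<alpha> = weight ?N" for \<alpha>
  proof -
    obtain x u where u: "\<alpha> = x # u" "length u = n - 1" "u @ [x] \<in> S"
      using S_Cons[OF \<alpha>] by metis
    let ?M = "u @ [True]"
    consider "\<not> necklace ?M" | "x" "necklace ?M" | "\<not> x" "necklace ?M" "?M \<notin> S"
      | "\<not> x" "necklace ?M" "?M \<in> S" by blast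
    then show ?thesis
    proof cases
      case 1
      then have "step \<alpha> = rotate1 \<alpha>" using step_rotate \<alpha> u by simp
      then show ?thesis using reaches_step[of step \<alpha>] by simp
    next
      case 2
      then show ?thesis using u by simp
    next
      case 3
      then have "step \<alpha> = rotate1 \<alpha>" using step_skip u by simp
      then show ?thesis using reaches_step[of step \<alpha>] by simp
    next
      case 4
      \<comment> \<open>The child is heavier by one and weights are at most \<open>n\<close>, so the
        measure decreases. The detour ends at \<open>u @ [False]\<close>, the rotation of
        \<open>\<alpha>\<close>.\<close>
      have "weight ?M \<le> n" using weight_le_length[of ?M] S_length[OF 4(3)] by simp
      moreover have "weight ?M = Suc (weight ?N)" using wt u 4 by simp
      ultimately have "n - weight ?M < n - weight ?N" by linarith
      then have "reaches step ?M (u @ [False])" using less.hyps 4 by blast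
      moreover have "reaches step \<alpha> ?M"
        using reaches_step[of step \<alpha>] step_enter[OF 4(3,2)] u 4 by simp
      ultimately show ?thesis using reaches_trans u 4 by fastforce
    qed
  qed
  have all: "reaches step ?N (rotate k ?N)" for k
  proof (induction k)
    case 0
    show ?case using reaches_refl[of step ?N] by simp
  next
    case (Suc k)
    have "rotate k ?N \<in> S" using S_rotate less.prems by blast
    then consider "reaches step (rotate k ?N) (rotate (Suc k) ?N)" | "necklace (rotate (Suc k) ?N)"
      using rot[of "rotate k ?N"] by auto
    then show ?case
    proof cases
      case 1
      then show ?thesis using Suc.IH reaches_trans by metis
    next
      case 2
      then have "rotate (Suc k) ?N = ?N" using necklace_unique[OF less.prems(2)] by blast
      then show ?thesis using reaches_refl[of step ?N] by metis
    qed
  qed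
  \<comment> \<open>\<open>True # v\<close> is the point of the class just before the necklace; the
    exit to the parent is taken from there.\<close>
  have "rotate (length v) ?N = True # v" by (simp add: rotate_append)
  then have "reaches step ?N (True # v)" and "True # v \<in> S"
    using all[of "length v"] S_rotate[OF less.prems(1), of "length v"] by simp_all
  then have "reaches step ?N (v @ [False])"
    using reaches_step[of step "True # v"] step_exit[OF _ less.prems(2)] reaches_trans by metis
  then show ?case using all by blast
qed

text \<open>The class of \<open>\<alpha>\<close> is entered at its necklace
  \<open>v @ [True]\<close> from \<open>False # v\<close>, which is lighter by one; from the
  necklace the whole class is reached.\<close>

lemma root_reaches:
  assumes "\<alpha> \<in> S"
  shows "reaches step root \<alpha>"
  using assms
proof (induction "weight \<alpha>" arbitrary: \<alpha> rule: less_induct)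
  case less
  show ?case
  proof (cases "weight \<alpha> = 0")
    case True
    then have "\<alpha> = root" using weight_eq_0D S_length[OF less.prems] by metis
    then show ?thesis using reaches_refl by metis
  next
    case False
    then have "\<alpha> \<noteq> []" by auto
    then obtain k where k: "necklace (rotate k \<alpha>)" using ex_necklace_rotate by blast
    obtain v where v: "rotate k \<alpha> = v @ [True]" using necklace_last[OF k] False by auto
    obtain l where l: "rotate l (v @ [True]) = \<alpha>" using rotate_inverse[of k \<alpha>] v by auto
    have N: "v @ [True] \<in> S" using S_rotate[OF less.prems, of k] v by simp
    have "weight \<alpha> = Suc (weight v)" using arg_cong[OF v, of weight] by simp
    then have "reaches step root (False # v)" using less.hyps S_parent(2)[OF N] by simp
    moreover have "reaches step (False # v) (v @ [True])"
      using reaches_step[of step "False # v"] step_enter[OF N] k v by simp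
    moreover have "reaches step (v @ [True]) \<alpha>"
      using necklace_traverses[OF N] k v l by metis
    ultimately show ?thesis using reaches_trans by metis
  qed
qed

lemma root_snoc: "root = replicate (n - 1) False @ [False]"
  using n_pos by (cases n) (auto simp: replicate_append_same)

text \<open>\<open>start\<close> is a necklace from which the orbit drops to \<open>root\<close>,
  and \<open>root\<close> steps back to \<open>start\<close>. As the root reaches everything, the
  orbit of \<open>start\<close> closes and fills \<open>S\<close>.\<close>

lemma step_is_cycle: "is_cycle step start S"
proof -
  have "reaches step start root"
    using necklace_traverses[OF S_single_one necklace_single_one] root_snoc by simp
  then have all: "reaches step start \<alpha>" if "\<alpha> \<in> S" for \<alpha>
    using root_reaches[OF that] reaches_trans by metis
  have "root = False # replicate (n - 1) False" using n_pos by (cases n) auto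
  then have "step root = start" using step_enter[OF S_single_one necklace_single_one] by simp
  moreover obtain k where "(step ^^ k) start = root"
    using \<open>reaches step start root\<close> unfolding reaches_def by blast
  ultimately have "(step ^^ Suc k) start = start" by simp
  then have ret: "\<exists>k>0. (step ^^ k) start = start" by blast
  have "(step ^^ k) start \<in> S" for k
    by (induction k) (use S_single_one step_in_S in auto)
  then have "range (\<lambda>k. (step ^^ k) start) = S"
    using all unfolding reaches_def by blast
  then show ?thesis using is_cycle_orbit(1)[OF ret] by simp
qed

text \<open>The map tests \<open>R\<close> before the correction for \<open>S\<close>, the right
  side after it. These can differ only if \<open>\<beta>\<close> is outside \<open>S\<close>, so
  \<open>\<beta> = v @ [True]\<close> is not in \<open>R\<close>. Nor is the corrected
  \<open>v @ [False]\<close>: members of \<open>R\<close> end in 1 unless they are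
  \<open>root\<close>, and then \<open>\<beta>\<close> would be \<open>start\<close>, a member of
  \<open>S\<close>.\<close>

lemma cut_step_eq:
  assumes \<alpha>: "\<alpha> \<in> S" and R: "\<And>\<gamma>. \<gamma> \<in> R \<Longrightarrow> \<gamma> \<in> S \<and> (\<gamma> = root \<or> last \<gamma>)"
  shows "cut_step S R \<alpha> = (if step \<alpha> \<in> R then flip_last (step \<alpha>) else step \<alpha>)"
proof -
  define \<beta> where "\<beta> = tl \<alpha> @ [pcr3 \<alpha>]"
  obtain x v where v: "\<alpha> = x # v" "v @ [x] \<in> S" using S_Cons[OF \<alpha>] by metis
  show ?thesis
  proof (cases "\<beta> \<in> S")
    case True
    then show ?thesis by (auto simp: cut_step_def Let_def \<beta>_def)
  next
    case False
    \<comment> \<open>If it ended in 0, \<open>\<beta>\<close> would be in \<open>S\<close>, either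
      as the rotation of \<open>\<alpha>\<close> or by lowering its last bit.\<close>
    have \<beta>: "\<beta> = v @ [True]"
    proof (rule ccontr)
      assume "\<beta> \<noteq> v @ [True]"
      then have "\<beta> = v @ [False]" using v by (cases "pcr3 \<alpha>") (auto simp: \<beta>_def)
      then show False using False v S_parent(1)[of v] by (cases x) auto
    qed
    have "v @ [False] \<notin> R"
    proof
      assume "v @ [False] \<in> R"
      then have "v @ [False] = root" using R by fastforce
      then have "\<beta> = start" using \<beta> root_snoc by simp
      then show False using False S_single_one by simp
    qed
    then show ?thesis using False \<beta> R v by (auto simp: cut_step_def Let_def \<beta>_def)
  qed
qed

end

subsection \<open>The strings \<open>\<gamma>\<^sub>i\<close> and their segments\<close>

definition block :: "nat \<Rightarrow> bool list" where
  "block c = replicate c False @ [True]"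

lemma length_block [simp]: "length (block c) = Suc c"
  by (simp add: block_def)

lemma weight_block [simp]: "weight (block c) = 1"
  by (simp add: block_def)

lemma weight_string_power [simp]: "weight (string_power u x) = x * weight u"
  by (induction x) auto

lemma string_power_commute: "string_power u x @ u = u @ string_power u x"
  by (induction x) auto

lemma string_power_concat_map: "string_power (f c) x = concat (map f (replicate x c))"
  by (simp add: string_power_def)

text \<open>The case \<open>i dvd n\<close> is absorbed by taking quotient and remainder of \<open>n - 1\<close> instead of \<open>n\<close>.\<close>

lemma gamma_string_eq:
  assumes "1 \<le> n" and "2 \<le> i"
  shows "gamma_string n i = block ((n - 1) mod i) @ string_power (block (i - 1)) ((n - 1) div i)"
proof -
  obtain n' where n: "n = Suc n'" using assms by (cases n) auto
  show ?thesis
  proof (cases "i dvd n")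
    case True
    then have "Suc (n' mod i) = i" using n assms
      by (metis dvd_imp_mod_0 mod_Suc nat.simps(3))
    then have "n' mod i = i - 1" by simp
    moreover have "n div i = Suc (n' div i)" using True n by (simp add: div_Suc)
    ultimately show ?thesis using True n assms by (simp add: gamma_string_def block_def)
  next
    case False
    then have "n mod i \<noteq> 0" by (simp add: dvd_eq_mod_eq_0)
    then have "n mod i = Suc (n' mod i)" "n div i = n' div i"
      using n by (auto simp: mod_Suc div_Suc split: if_splits)
    then show ?thesis using False n assms by (simp add: gamma_string_def block_def)
  qed
qed

lemma replicate_False_less:
  "a < b \<Longrightarrow> replicate b False @ p < replicate a False @ True # q"
proof (induction a arbitrary: b)
  case 0
  then show ?case by (cases b) auto
next
  case (Suc a)
  then show ?case by (cases b) auto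
qed

text \<open>Rotating the later, longer run of zeros to the front gives a smaller string.\<close>

lemma not_necklaceI:
  assumes "a < b"
  shows "\<not> necklace (replicate a False @ True # u @ replicate b False @ v)"
proof
  let ?M = "(replicate a False @ True # u) @ (replicate b False @ v)"
  assume "necklace (replicate a False @ True # u @ replicate b False @ v)"
  then have "necklace ?M" by simp
  then have "?M \<le> rotate (length (replicate a False @ True # u)) ?M"
    unfolding necklace_def by blast
  also have "\<dots> = replicate b False @ v @ replicate a False @ True # u"
    unfolding rotate_append by simp
  also have "\<dots> < replicate a False @ True # u @ replicate b False @ v"
    using assms by (rule replicate_False_less)
  finally show False by simp
qed

text \<open>Used to describe all rotations of a string of blocks: the cut falls inside some block
  \<open>a\<close>, after \<open>r\<close> of its zeros. Nonemptiness of \<open>v\<close> guarantees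
  that such a block exists.\<close>

lemma split_blocks:
  assumes "concat (map block as) = u @ v" and "v \<noteq> []"
  shows "\<exists>as1 a as2 r. as = as1 @ a # as2 \<and> r \<le> a \<and> u = concat (map block as1) @ replicate r False
    \<and> v = replicate (a - r) False @ True # concat (map block as2)"
  using assms
proof (induction as arbitrary: u)
  case (Cons a as)
  show ?case
  proof (cases "length u \<le> a")
    case True
    define r where "r = length u"
    let ?w = "replicate a False @ True # concat (map block as)"
    have eq: "?w = u @ v" using Cons.prems by (simp add: block_def[of a])
    then have "u = take r ?w" "v = drop r ?w" by (simp_all add: r_def)
    then have "u = replicate r False" "v = replicate (a - r) False @ True # concat (map block as)"
      using True by (simp_all add: r_def)
    then show ?thesis using True
      by (intro exI[of _ "[]"] exI[of _ a] exI[of _ as] exI[of _ r]) (simp add: r_def)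
  next
    case False
    then have "length (block a) \<le> length u" by simp
    then have "block a = take (length (block a)) u"
      using Cons.prems(1) by (simp add: append_eq_append_conv_if)
    then obtain u' where u: "u = block a @ u'" by (metis append_take_drop_id)
    then obtain as1 b as2 r where *: "as = as1 @ b # as2" "r \<le> b"
      "u' = concat (map block as1) @ replicate r False"
      "v = replicate (b - r) False @ True # concat (map block as2)"
      using Cons.IH[of u'] Cons.prems by auto
    show ?thesis
      by (intro exI[of _ "a # as1"] exI[of _ b] exI[of _ as2] exI[of _ r]) (use * u in simp)
  qed
qed simp

lemma append_le_cancel_left: "u @ v \<le> u @ w \<longleftrightarrow> v \<le> (w :: bool list)"
  by (induction u) auto

text \<open>A rotation either starts with fewer than \<open>c\<close> zeros and is larger at once,
  or starts at a full block. In the latter case it changes nothing if \<open>y = c\<close>, and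
  otherwise moves the short block forward, where its early 1 cannot make the string smaller.\<close>

lemma necklace_blocks:
  assumes "1 \<le> x" and "y \<le> c"
  shows "necklace (string_power (block c) x @ block y)"
  unfolding necklace_def
proof
  fix k
  let ?w = "string_power (block c) x @ block y"
  define k' where "k' = k mod length ?w"
  have "k' < length ?w" unfolding k'_def by (rule mod_less_divisor) simp
  define u v where "u = take k' ?w" and "v = drop k' ?w"
  have rot: "rotate k ?w = v @ u" unfolding u_def v_def k'_def by (rule rotate_drop_take)
  have "v \<noteq> []" using \<open>k' < length ?w\<close> unfolding v_def by (simp only: drop_eq_Nil not_le)
  let ?as = "replicate x c @ [y]"
  have w: "?w = concat (map block ?as)" by (simp add: string_power_concat_map)
  have "concat (map block ?as) = u @ v" unfolding w[symmetric] u_def v_def append_take_drop_id ..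
  then obtain as1 a as2 r where as: "?as = as1 @ a # as2" and r: "r \<le> a"
    and u: "u = concat (map block as1) @ replicate r False"
    and v: "v = replicate (a - r) False @ True # concat (map block as2)"
    using split_blocks \<open>v \<noteq> []\<close> by blast
  have "a \<in> set ?as" unfolding as by simp
  then have "a \<le> c" using assms by auto
  obtain x' where x: "x = Suc x'" using assms by (cases x) auto
  show "?w \<le> rotate k ?w"
  proof (cases "a - r < c")
    case True
    have "?w = replicate c False @ (True # string_power (block c) x' @ block y)"
      by (simp add: x block_def)
    also have "\<dots> < replicate (a - r) False @ True # (concat (map block as2) @ u)"
      using True by (rule replicate_False_less)
    finally show ?thesis unfolding rot v by simp
  next
    case False
    then have ac: "a = c" "r = 0" using r \<open>a \<le> c\<close> by auto
    then have vu: "v @ u = concat (map block (c # as2)) @ concat (map block as1)"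
      using u v by (simp add: block_def)
    show ?thesis
    proof (cases "y = c")
      case True
      have "?as = replicate (Suc x) c" using True by (simp add: replicate_append_same)
      then have all: "\<forall>b \<in> set (as1 @ a # as2). b = c" unfolding as[symmetric] by auto
      have "as1 @ c # as2 = replicate (Suc (length as1 + length as2)) c"
        by (rule replicate_eqI) (use all in auto)
      moreover have "c # as2 @ as1 = replicate (Suc (length as1 + length as2)) c"
        by (rule replicate_eqI) (use all in auto)
      ultimately have "as1 @ c # as2 = (c # as2) @ as1" by simp
      then have "?w = concat (map block ((c # as2) @ as1))" unfolding w as ac by (rule arg_cong)
      then have "?w = v @ u" unfolding vu by (simp only: map_append concat_append)
      then show ?thesis unfolding rot by simp
    next
      case False
      have "as2 \<noteq> []" using as ac False by auto
      then obtain as2' where as2: "as2 = as2' @ [y]" using as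
        by (metis append_butlast_last_id last.simps last_appendR last_snoc list.distinct(1))
      have "replicate x c = as1 @ c # as2'" using as ac as2 by simp
      then have all: "\<forall>b \<in> set (as1 @ c # as2'). b = c" by (metis in_set_replicate)
      have r1: "as1 = replicate (length as1) c" by (rule replicate_eqI) (use all in auto)
      have r2: "c # as2' = replicate (Suc (length as2')) c"
        by (rule replicate_eqI) (use all in auto)
      obtain p q where p: "c # as2' = replicate p c" and q: "as1 = replicate q c"
        using r1 r2 by blast
      have "replicate x c = replicate q c @ replicate p c"
        using \<open>replicate x c = as1 @ c # as2'\<close> unfolding p q .
      then have xpq: "x = p + q" by (metis add.commute length_append length_replicate)
      have "c # as2 = replicate p c @ [y]" using p as2 by (metis append_Cons)
      then have vu': "v @ u = concat (map block (replicate p c)) @ block y @ concat (map block (replicate q c))"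
        unfolding vu q by (simp del: map_replicate)
      have ww: "?w = concat (map block (replicate p c)) @ concat (map block (replicate q c)) @ block y"
        unfolding w unfolding xpq by (simp add: replicate_add del: map_replicate)
      \<comment> \<open>After the common prefix of \<open>p\<close> full blocks, \<open>c\<close>
        zeros are compared with \<open>y\<close> zeros; for \<open>q = 0\<close> both sides
        coincide.\<close>
      have "concat (map block (replicate q c)) @ block y \<le> block y @ concat (map block (replicate q c))"
      proof (cases q)
        case (Suc q')
        have "y < c" using False assms by simp
        have "concat (map block (replicate q c)) @ block y
          = replicate c False @ (True # concat (map block (replicate q' c)) @ block y)"
          using Suc by (simp add: block_def)
        also have "\<dots> < replicate y False @ True # concat (map block (replicate q c))"
          using \<open>y < c\<close> by (rule replicate_False_less)
        finally show ?thesis by (simp add: block_def)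
      qed simp
      then show ?thesis unfolding rot vu' unfolding ww append_le_cancel_left .
    qed
  qed
qed

context weight_truncation
begin

text \<open>
  The orbit first rotates \<open>\<gamma>\<^sub>i = 0\<^sup>y 1 (0\<^bsup>i-1\<^esup> 1)\<^sup>x\<close> until it reaches its necklace after \<open>y + 1\<close> steps,
  where it drops to the parent, and then rotates that parent.
\<close>

lemma gamma_orbit:
  assumes i: "2 \<le> i" and y: "y < i" and x: "1 \<le> x" and xy: "x = 1 \<longrightarrow> i \<le> y + 2"
    and \<gamma>: "\<gamma> = block y @ string_power (block (i - 1)) x" and \<gamma>S: "\<gamma> \<in> S"
  shows "k \<le> y \<Longrightarrow> (step ^^ k) \<gamma> =
      replicate (y - k) False @ True # string_power (block (i - 1)) x @ replicate k False" (is "_ \<Longrightarrow> ?A k")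
    and "l \<le> i - 1 - y \<Longrightarrow> (step ^^ (Suc y + l)) \<gamma> = replicate (i - 1 - l) False @ True #
      string_power (block (i - 1)) (x - 1) @ replicate (Suc y + l) False" (is "_ \<Longrightarrow> ?B l")
proof -
  let ?P = "string_power (block (i - 1))"
  have Px: "?P (Suc x') = replicate (i - 1) False @ True # ?P x'" for x'
    by (simp add: block_def)
  have inS: "(step ^^ k) \<gamma> \<in> S" for k
    by (induction k) (use \<gamma>S step_in_S in auto)
  have phase1: "?A k" if "k \<le> y" for k
    using that
  proof (induction k)
    case 0
    then show ?case by (simp add: \<gamma> block_def)
  next
    case (Suc k)
    then have yk: "y - k = Suc (y - Suc k)" by simp
    let ?v = "replicate (y - Suc k) False @ True # ?P x @ replicate k False"
    have eq: "(step ^^ k) \<gamma> = False # ?v" using Suc yk by simp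
    \<comment> \<open>A full run of \<open>i - 1\<close> zeros follows the shorter leading run, so
      this is no necklace.\<close>
    have "?v @ [True] = replicate (y - Suc k) False @ True # [] @ replicate (i - 1) False
        @ (True # ?P (x - 1) @ replicate k False @ [True])"
      using x Px[of "x - 1"] by simp
    moreover have "y - Suc k < i - 1" using y Suc.prems by linarith
    ultimately have "\<not> necklace (?v @ [True])" using not_necklaceI by metis
    then have "step (False # ?v) = ?v @ [False]" using inS[of k] eq by (intro step_rotate) auto
    then show ?case using eq by (simp add: replicate_append_same)
  qed
  then show "k \<le> y \<Longrightarrow> ?A k" by blast
  have mid: "(step ^^ Suc y) \<gamma> = ?P x @ replicate (Suc y) False"
  proof -
    let ?v = "?P x @ replicate y False"
    have eq: "(step ^^ y) \<gamma> = True # ?v" using phase1[of y] by simp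
    \<comment> \<open>This is the necklace in the class of \<open>\<gamma>\<close>, so the leading 1
      turns into a final 0 and the weight drops to \<open>x\<close>.\<close>
    have "necklace (?v @ [True])" using necklace_blocks[of x y "i - 1"] x y by (simp add: block_def)
    then have "step (True # ?v) = ?v @ [False]" using inS[of y] eq by (intro step_exit) auto
    then show ?thesis using eq by (simp add: replicate_append_same)
  qed
  show "?B l" if "l \<le> i - 1 - y" for l
    using that
  proof (induction l)
    case 0
    then show ?case using mid x Px[of "x - 1"] by simp
  next
    case (Suc l)
    then have il: "i - 1 - l = Suc (i - 1 - Suc l)" by simp
    let ?v = "replicate (i - 1 - Suc l) False @ True # ?P (x - 1) @ replicate (Suc y + l) False"
    have eq: "(step ^^ (Suc y + l)) \<gamma> = False # ?v" using Suc il by simp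
    \<comment> \<open>For \<open>x = 1\<close> no full run of zeros is left further on, and the
      trailing zeros must outnumber the leading ones, which \<open>i \<le> y + 2\<close> ensures.
      For larger \<open>x\<close> a full run remains.\<close>
    have "\<not> necklace (?v @ [True])"
    proof (cases "x = 1")
      case True
      then have "i - 1 - Suc l < Suc y + l" using xy by linarith
      from not_necklaceI[OF this, of "[]" "[True]"] show ?thesis using True by simp
    next
      case False
      then have "?v @ [True] = replicate (i - 1 - Suc l) False @ True # [] @ replicate (i - 1) False
        @ (True # ?P (x - 2) @ replicate (Suc y + l) False @ [True])"
        using x Px[of "x - 2"] by (simp add: numeral_2_eq_2 Suc_diff_Suc)
      moreover have "i - 1 - Suc l < i - 1" using i by linarith
      ultimately show ?thesis using not_necklaceI by metis
    qed
    then have "step (False # ?v) = ?v @ [False]"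
      using inS[of "Suc y + l"] eq by (intro step_rotate) auto
    then show ?case using eq by (simp add: replicate_append_same)
  qed
qed

text \<open>For \<open>i \<ge> 2\<close>, the drop at step \<open>y + 1\<close> and the
  \<open>i - 1 - y\<close> rotations after it realign the string with its origin except for the last
  1. The second claim later separates a segment from \<open>start\<close> and from the other
  segment: before the drop the weight is unchanged, afterwards the string is nonzero and ends in
  0.\<close>

lemma gamma_segment:
  assumes i: "1 \<le> i" "2 * i \<le> n + 1" and \<gamma>S: "gamma_string n i \<in> S"
  shows "(step ^^ i) (gamma_string n i) = flip_last (gamma_string n i)" (is ?A)
    and "k < i \<Longrightarrow> weight ((step ^^ k) (gamma_string n i)) = weight (gamma_string n i) \<or>
      \<not> last ((step ^^ k) (gamma_string n i)) \<and> 0 < weight ((step ^^ k) (gamma_string n i))" (is "_ \<Longrightarrow> ?B k")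
proof -
  have "?A \<and> (\<forall>k<i. ?B k)"
  proof (cases "i = 1")
    case True
    have "root = False # replicate (n - 1) False" using n_pos by (cases n) auto
    then have "step root = start" using step_enter[OF S_single_one necklace_single_one] by simp
    then have ?A using True root_snoc by (simp add: gamma_string_def)
    then show ?thesis using True by simp
  next
    case False
    then have i2: "2 \<le> i" using i by simp
    define x where "x = (n - 1) div i"
    define y where "y = (n - 1) mod i"
    have n: "n = x * i + y + 1" using n_pos unfolding x_def y_def by simp
    have y: "y < i" using i2 unfolding y_def by simp
    have x: "1 \<le> x" using i i2 n y by (cases x) auto
    \<comment> \<open>For \<open>x = 1\<close> the length is \<open>i + y + 1\<close>, so
      \<open>2 * i \<le> n + 1\<close> reads \<open>i \<le> y + 2\<close>.\<close>
    have xy: "x = 1 \<longrightarrow> i \<le> y + 2" using n i by auto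
    let ?\<gamma> = "gamma_string n i"
    have \<gamma>: "?\<gamma> = block y @ string_power (block (i - 1)) x"
      using gamma_string_eq[OF n_pos i2] by (simp add: x_def y_def)
    note orbit = gamma_orbit[OF i2 y x xy \<gamma> \<gamma>S]
    have wt: "weight ?\<gamma> = Suc x" using \<gamma> by simp
    have A: ?A
    proof -
      let ?u = "replicate y False @ True # string_power (block (i - 1)) (x - 1) @ replicate (i - 1) False"
      have "replicate i False = replicate (i - 1) False @ [False]"
        using i2 by (cases i) (auto simp: replicate_append_same)
      then have "(step ^^ i) ?\<gamma> = ?u @ [False]"
        using orbit(2)[of "i - 1 - y"] y by simp
      moreover have "?\<gamma> = ?u @ [True]"
      proof -
        have "string_power (block (i - 1)) x = string_power (block (i - 1)) (x - 1) @ block (i - 1)"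
          using x string_power_commute[of "block (i - 1)" "x - 1"] by (cases x) auto
        then show ?thesis using \<gamma> by (simp add: block_def)
      qed
      ultimately show ?thesis using flip_last_snoc[of ?u True] by (simp only: not_True_eq_False)
    qed
    have "?B k" if "k < i" for k
    proof (cases "k \<le> y")
      case True
      then show ?thesis using orbit(1)[of k] wt by simp
    next
      case False
      define l where "l = k - Suc y"
      have k: "k = Suc y + l" and l: "l \<le> i - 1 - y" using False that by (auto simp: l_def)
      have eq: "(step ^^ k) ?\<gamma> = (replicate (i - 1 - l) False @ True #
        string_power (block (i - 1)) (x - 1) @ replicate (y + l) False) @ [False]"
        using orbit(2)[OF l] unfolding k by (simp add: replicate_append_same)
      then show ?thesis unfolding eq by simp
    qed
    then show ?thesis using A by blast
  qed
  then show ?A and "k < i \<Longrightarrow> ?B k" by blast+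
qed

end

lemma weight_gamma_string:
  assumes "1 \<le> n" and "2 \<le> i"
  shows "weight (gamma_string n i) = Suc ((n - 1) div i)"
  using gamma_string_eq[OF assms] by simp

lemma length_gamma_string:
  assumes "1 \<le> n" and "1 \<le> i"
  shows "length (gamma_string n i) = n"
proof (cases "i = 1")
  case True
  then show ?thesis by (simp add: gamma_string_def)
next
  case False
  then have i: "2 \<le> i" using assms by simp
  have "(n - 1) mod i + (n - 1) div i * i = n - 1" by (rule mod_div_mult_eq)
  then show ?thesis using i assms gamma_string_eq[OF assms(1) i] by simp
qed

lemma last_gamma_string:
  assumes "1 \<le> n" and "2 \<le> i"
  shows "last (gamma_string n i)"
proof (cases "(n - 1) div i")
  case 0
  then show ?thesis using gamma_string_eq[OF assms] by (simp add: block_def)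
next
  case (Suc x)
  have "last (string_power (block (i - 1)) (Suc x))"
    unfolding string_power_Suc string_power_commute[symmetric] by (simp add: block_def)
  then show ?thesis using gamma_string_eq[OF assms] Suc
    by (metis last_appendR length_block length_string_power list.size(3) mult_eq_0_iff nat.simps(3))
qed

subsection \<open>Counting\<close>

lemma card_binary_strings: "finite (binary_strings n)" "card (binary_strings n) = 2 ^ n"
  using finite_lists_length_eq[of "UNIV :: bool set" n] card_lists_length_eq[of "UNIV :: bool set" n]
  by (simp_all add: binary_strings_def)

lemma weight_map_Not: "weight (map Not u) + weight u = length u"
  by (induction u) auto

text \<open>Complementation sends these strings injectively to strings of weight at least
  \<open>n - w > w\<close>, so they are at most half of all. Hence \<open>L > 2 ^ (n - 1)\<close>
  will force \<open>n \<le> 2 * m\<close>.\<close>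

lemma num_weight_le_half:
  assumes "2 * w < n"
  shows "num_weight_le n w \<le> 2 ^ (n - 1)"
proof -
  let ?A = "{\<alpha> \<in> binary_strings n. weight \<alpha> \<le> w}"
  let ?B = "map Not ` ?A"
  have card: "card ?B = card ?A"
    by (rule card_image) (auto intro!: inj_onI simp: inj_map_eq_map inj_def)
  have fin: "finite ?A" using card_binary_strings(1) by simp
  have wB: "n - w \<le> weight \<beta>" if "\<beta> \<in> ?B" for \<beta>
  proof -
    obtain \<alpha> where "\<beta> = map Not \<alpha>" "length \<alpha> = n" "weight \<alpha> \<le> w"
      using \<open>\<beta> \<in> ?B\<close> unfolding binary_strings_def by blast
    then show ?thesis using weight_map_Not[of \<alpha>] by simp
  qed
  have "?A \<inter> ?B = {}"
  proof (rule ccontr)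
    assume "?A \<inter> ?B \<noteq> {}"
    then obtain \<beta> where "weight \<beta> \<le> w" "\<beta> \<in> ?B" by blast
    then show False using wB[of \<beta>] assms by linarith
  qed
  then have "card (?A \<union> ?B) = 2 * card ?A"
    using fin card by (subst card_Un_disjoint) auto
  moreover have "card (?A \<union> ?B) \<le> 2 ^ n"
    unfolding card_binary_strings(2)[symmetric]
    by (rule card_mono[OF card_binary_strings(1)]) (auto simp: binary_strings_def)
  moreover have "(2::nat) ^ n = 2 * 2 ^ (n - 1)" using assms by (cases n) auto
  ultimately show ?thesis unfolding num_weight_le_def by linarith
qed

text \<open>Attainment and minimality of the nested least choices. In particular
  \<open>t - 1\<close> cycles of size \<open>h\<close> fall short of \<open>L\<close>, which keeps
  the surplus \<open>s\<close> below \<open>h\<close>.\<close>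

lemma cut_parameters:
  assumes n: "n \<ge> 1" and L: "2 ^ (n - 1) < L" "L \<le> 2 ^ n"
    and m: "m = cut_m n L" and h: "h = cut_h n L" and t: "t = cut_t n L" and s: "s = cut_s n L"
  shows "n \<le> 2 * m" and "0 < h" and "h \<le> n" and "0 < t" and "s < h"
    and "num_weight_le n (m - 1) + num_weight_period_le n m (h - 1) + t * h = L + s"
proof -
  let ?A = "num_weight_le n" and ?C = "num_weight_period_le n m"
  have "?A n = 2 ^ n"
  proof -
    have "{\<alpha> \<in> binary_strings n. weight \<alpha> \<le> n} = binary_strings n"
      using weight_le_length unfolding binary_strings_def by blast
    then show ?thesis by (simp add: num_weight_le_def card_binary_strings)
  qed
  then have ex: "\<exists>w. L \<le> ?A w" using L(2) by (intro exI[of _ n]) simp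
  have m_eq: "m = (LEAST w. L \<le> ?A w)" unfolding m cut_m_def ..
  have Am: "L \<le> ?A m" unfolding m_eq by (rule LeastI_ex[OF ex])
  show nm: "n \<le> 2 * m"
  proof (rule ccontr)
    assume "\<not> n \<le> 2 * m"
    then show False using num_weight_le_half[of m n] Am L by simp
  qed
  then have "m - 1 < m" using n by simp
  then have Am1: "?A (m - 1) < L"
    using not_less_Least[of "m - 1" "\<lambda>w. L \<le> ?A w", folded m_eq] by simp
  have h_eq: "h = (LEAST p. L \<le> ?A (m - 1) + ?C p)"
    unfolding h cut_h_def m Let_def ..
  have "?A m \<le> ?A (m - 1) + ?C n"
  proof -
    have "{\<alpha> \<in> binary_strings n. weight \<alpha> \<le> m} \<subseteq> {\<alpha> \<in> binary_strings n. weight \<alpha> \<le> m - 1}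
      \<union> {\<alpha> \<in> binary_strings n. weight \<alpha> = m \<and> period \<alpha> \<le> n}"
    proof
      fix \<alpha> assume \<alpha>: "\<alpha> \<in> {\<alpha> \<in> binary_strings n. weight \<alpha> \<le> m}"
      then have "\<alpha> \<noteq> []" using n by (auto simp: binary_strings_def)
      then show "\<alpha> \<in> {\<alpha> \<in> binary_strings n. weight \<alpha> \<le> m - 1}
        \<union> {\<alpha> \<in> binary_strings n. weight \<alpha> = m \<and> period \<alpha> \<le> n}"
        using \<alpha> period_le_length[of \<alpha>] by (auto simp: binary_strings_def)
    qed
    then have "?A m \<le> card ({\<alpha> \<in> binary_strings n. weight \<alpha> \<le> m - 1}
      \<union> {\<alpha> \<in> binary_strings n. weight \<alpha> = m \<and> period \<alpha> \<le> n})"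
      unfolding num_weight_le_def by (intro card_mono) (auto simp: card_binary_strings)
    also have "\<dots> \<le> ?A (m - 1) + ?C n"
      unfolding num_weight_le_def num_weight_period_le_def by (rule card_Un_le)
    finally show ?thesis .
  qed
  then have Cn: "L \<le> ?A (m - 1) + ?C n" using Am by simp
  then show "h \<le> n" unfolding h_eq by (rule Least_le)
  have Ch: "L \<le> ?A (m - 1) + ?C h" unfolding h_eq using Cn by (rule LeastI)
  \<comment> \<open>No string has period 0, so \<open>h\<close> is positive and \<open>h - 1\<close>
    does not truncate.\<close>
  have "?C 0 = 0"
  proof -
    have "{\<alpha> \<in> binary_strings n. weight \<alpha> = m \<and> period \<alpha> \<le> 0} = {}"
    proof (rule equals0I)
      fix \<alpha> assume \<alpha>: "\<alpha> \<in> {\<alpha> \<in> binary_strings n. weight \<alpha> = m \<and> period \<alpha> \<le> 0}"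
      then have "\<alpha> \<noteq> []" using n by (auto simp: binary_strings_def)
      then show False using \<alpha> period_pos[of \<alpha>] by simp
    qed
    then show ?thesis unfolding num_weight_period_le_def by (simp only: card.empty)
  qed
  then have "h \<noteq> 0" using Ch Am1 by (intro notI) simp
  then show "0 < h" by simp
  then have "h - 1 < h" by simp
  then have base: "?A (m - 1) + ?C (h - 1) < L"
    using not_less_Least[of "h - 1" "\<lambda>p. L \<le> ?A (m - 1) + ?C p", folded h_eq] by simp
  let ?b = "?A (m - 1) + ?C (h - 1)"
  have t_eq: "t = (LEAST t. L \<le> ?b + t * h)"
    unfolding t cut_t_def h m Let_def ..
  \<comment> \<open>\<open>L\<close> cycles certainly suffice since \<open>h > 0\<close>; this is
    the witness that the least \<open>t\<close> exists.\<close>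
  have "L \<le> ?b + L * h" using \<open>0 < h\<close> by (simp add: trans_le_add2)
  then have bt: "L \<le> ?b + t * h" unfolding t_eq by (rule LeastI)
  have "t \<noteq> 0" using bt base by (intro notI) simp
  then show "0 < t" by simp
  then have "t - 1 < t" by simp
  then have bt1: "?b + (t - 1) * h < L"
    using not_less_Least[of "t - 1" "\<lambda>t. L \<le> ?b + t * h", folded t_eq] by simp
  have s_eq: "s = ?b + t * h - L"
    unfolding s cut_s_def t h m Let_def by (simp only: mult.commute)
  have "t * h = (t - 1) * h + h" using \<open>0 < t\<close> by (cases t) auto
  then show "s < h" using bt bt1 s_eq by linarith
  show "?b + t * h = L + s" using s_eq bt by linarith
qed

section \<open>The set \<open>S\<close>: its size and closure properties\<close>

lemma pcr_cycle_eqI: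
  assumes "u \<in> pcr_cycle \<alpha>"
  shows "pcr_cycle u = pcr_cycle \<alpha>"
proof -
  obtain k where "u = rotate k \<alpha>" using assms unfolding pcr_cycle_def by blast
  then show ?thesis by (simp only: pcr_cycle_rotate)
qed

lemma self_in_pcr_cycle: "\<alpha> \<in> pcr_cycle \<alpha>"
  unfolding pcr_cycle_def by (intro CollectI exI[of _ 0]) simp

lemma weight_eq_1_rotate:
  assumes "weight \<alpha> = 1"
  shows "\<exists>k. rotate k \<alpha> = replicate (length \<alpha> - 1) False @ [True]"
proof -
  have "\<alpha> \<noteq> []" using assms by auto
  then obtain k where k: "necklace (rotate k \<alpha>)" using ex_necklace_rotate by blast
  then obtain v where v: "rotate k \<alpha> = v @ [True]" using necklace_last assms by fastforce
  have "weight v = 0" using arg_cong[OF v, of weight] assms by simp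
  moreover have "length v = length \<alpha> - 1" using arg_cong[OF v, of length] by simp
  ultimately have "v = replicate (length \<alpha> - 1) False" using weight_eq_0D by metis
  then show ?thesis using v by auto
qed

locale cut_set =
  fixes n m h t :: nat and Cs :: "bool list set set"
  assumes n: "1 \<le> n" and nm: "n \<le> 2 * m" and h: "0 < h" and t: "0 < t" and card_Cs: "card Cs = t"
    and Cs: "Cs \<subseteq> {pcr_cycle \<alpha> | \<alpha>. \<alpha> \<in> binary_strings n \<and> weight \<alpha> = m \<and> period \<alpha> = h}"
begin

abbreviation "S \<equiv> cut_S n m h (\<Union> Cs)"

lemma Cs_props:
  assumes "C \<in> Cs" and "u \<in> C"
  shows "C = pcr_cycle u" and "length u = n" and "weight u = m" and "period u = h"
proof -
  obtain \<alpha> where \<alpha>: "C = pcr_cycle \<alpha>" "length \<alpha> = n" "weight \<alpha> = m" "period \<alpha> = h"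
    using assms Cs unfolding binary_strings_def by blast
  then show "C = pcr_cycle u" using pcr_cycle_eqI assms by blast
  obtain k where "u = rotate k \<alpha>" using \<alpha> assms unfolding pcr_cycle_def by blast
  then show "length u = n" "weight u = m" "period u = h" using \<alpha> period_rotate by auto
qed

text \<open>The three layers are disjoint by weight and period, and distinct cycles are disjoint
  with \<open>h\<close> strings each, the period being the cycle size. By
  \<open>cut_parameters\<close> the total is \<open>L + s\<close>.\<close>

lemma card_cut_S:
  "card S = num_weight_le n (m - 1) + num_weight_period_le n m (h - 1) + t * h"
proof -
  let ?W = "{\<alpha> \<in> binary_strings n. weight \<alpha> < m}"
  let ?P = "{\<alpha> \<in> binary_strings n. weight \<alpha> = m \<and> period \<alpha> < h}"
  have fin: "finite ?W" "finite ?P" using card_binary_strings by auto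
  have "finite Cs" using card_Cs t card_gt_0_iff by metis
  have "C \<noteq> {}" if "C \<in> Cs" for C using that Cs self_in_pcr_cycle by blast
  then have cardC: "card C = h" if "C \<in> Cs" for C
    using that Cs_props card_pcr_cycle n
    by (metis all_not_in_conv list.size(3) not_one_le_zero)
  have finC: "finite C" if "C \<in> Cs" for C
    using cardC[OF that] h card_gt_0_iff by metis
  have "card (\<Union> Cs) = sum card Cs"
  proof (rule card_Union_disjoint)
    show "pairwise disjnt Cs"
    proof (rule pairwiseI)
      fix C D assume CD: "C \<in> Cs" "D \<in> Cs" "C \<noteq> D"
      show "disjnt C D"
      proof (rule ccontr)
        assume "\<not> disjnt C D"
        then obtain u where "u \<in> C" "u \<in> D" unfolding disjnt_def by blast
        then show False using CD Cs_props(1)[of C u] Cs_props(1)[of D u] by simp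
      qed
    qed
  qed (rule finC)
  also have "\<dots> = t * h" using cardC card_Cs by simp
  finally have cardT: "card (\<Union> Cs) = t * h" .
  have finT: "finite (\<Union> Cs)" using \<open>finite Cs\<close> finC by blast
  have "m > 0" using n nm by simp
  then have W: "card ?W = num_weight_le n (m - 1)"
    unfolding num_weight_le_def by (intro arg_cong[of _ _ card]) auto
  have P: "card ?P = num_weight_period_le n m (h - 1)"
    unfolding num_weight_period_le_def using h by (intro arg_cong[of _ _ card]) auto
  have "(?W \<union> ?P) \<inter> \<Union> Cs = {}"
  proof (rule equals0I)
    fix u assume u: "u \<in> (?W \<union> ?P) \<inter> \<Union> Cs"
    then obtain C where "C \<in> Cs" "u \<in> C" by blast
    then have "weight u = m" "period u = h" using Cs_props(3,4) by blast+
    then show False using u by simp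
  qed
  then have "card S = card (?W \<union> ?P) + card (\<Union> Cs)"
    unfolding cut_S_def using fin finT by (intro card_Un_disjoint) auto
  also have "card (?W \<union> ?P) = card ?W + card ?P"
    using fin by (intro card_Un_disjoint) auto
  finally show ?thesis using W P cardT by simp
qed

sublocale weight_truncation n m S
proof
  show "1 \<le> n" by (rule n)
  show "length \<alpha> = n" if "\<alpha> \<in> S" for \<alpha>
    using that Cs_props(2) unfolding cut_S_def binary_strings_def by blast
  show "weight \<alpha> \<le> m" if "\<alpha> \<in> S" for \<alpha>
    using that Cs_props(3)[of _ \<alpha>] unfolding cut_S_def binary_strings_def by auto
  show low: "\<alpha> \<in> S" if "length \<alpha> = n" "weight \<alpha> < m" for \<alpha>
    using that unfolding cut_S_def binary_strings_def by blast
  show "rotate1 \<alpha> \<in> S" if "\<alpha> \<in> S" for \<alpha>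
  proof (cases "\<alpha> \<in> \<Union> Cs")
    case True
    then obtain C where C: "C \<in> Cs" "\<alpha> \<in> C" by blast
    have "rotate1 \<alpha> \<in> pcr_cycle \<alpha>"
      unfolding pcr_cycle_def by (intro CollectI exI[of _ 1]) simp
    then show ?thesis using C Cs_props(1)[OF C] unfolding cut_S_def by blast
  next
    case False
    have "period (rotate1 \<alpha>) = period \<alpha>" using period_rotate[of 1 \<alpha>] by simp
    then show ?thesis using that False unfolding cut_S_def binary_strings_def by auto
  qed
  show "replicate (n - 1) False @ [True] \<in> S"
  proof (cases "1 < m")
    case True
    then show ?thesis using n by (intro low) auto
  next
    \<comment> \<open>For \<open>m = 1\<close> the strings of weight 1 form a single PCR cycle, so
      any chosen cycle contains the starting string; one is chosen because
      \<open>t > 0\<close>.\<close>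
    case False
    then have "m = 1" using n nm by simp
    have "Cs \<noteq> {}" using card_Cs t by auto
    then obtain C where C: "C \<in> Cs" by blast
    then obtain \<alpha> where \<alpha>: "C = pcr_cycle \<alpha>" "length \<alpha> = n" "weight \<alpha> = 1"
      using Cs \<open>m = 1\<close> unfolding binary_strings_def by blast
    obtain k where "rotate k \<alpha> = replicate (n - 1) False @ [True]"
      using weight_eq_1_rotate[OF \<alpha>(3)] \<alpha>(2) by blast
    then have "replicate (n - 1) False @ [True] \<in> C"
      unfolding \<alpha>(1) pcr_cycle_def by (intro CollectI exI[of _ k]) simp
    then show ?thesis using C unfolding cut_S_def by blast
  qed
qed

text \<open>For \<open>i \<ge> 2\<close> the weight is \<open>1 + (n - 1) div i\<close>, and with
  \<open>n \<le> 2 * m\<close> only \<open>i = 2\<close> can attain \<open>m\<close>. Then even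
  \<open>n\<close> gives a period of at most 2, below \<open>h\<close>, while odd \<open>n\<close>
  equals \<open>2 * m - 1\<close> and falls under the assumption on the chosen cycles.\<close>

lemma gamma_string_in_S:
  assumes i: "1 \<le> i" "2 * i \<le> n + 1" "i < h"
    and alt: "n + 1 = 2 * m \<Longrightarrow> pcr_cycle (string_power [False, True] (m - 1) @ [True]) \<subseteq> \<Union> Cs"
  shows "gamma_string n i \<in> S"
proof -
  let ?\<gamma> = "gamma_string n i"
  have len: "length ?\<gamma> = n" using length_gamma_string n i by blast
  consider "i = 1" | "i = 2" | "3 \<le> i" using i by linarith
  then show ?thesis
  proof cases
    case 1
    then show ?thesis using len n nm by (intro S_low) (auto simp: gamma_string_def)
  next
    case 2
    have wt: "weight ?\<gamma> = Suc ((n - 1) div 2)" using weight_gamma_string[OF n, of 2] 2 by simp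
    show ?thesis
    proof (cases "weight ?\<gamma> < m")
      case True
      then show ?thesis using len by (intro S_low)
    next
      case False
      have m: "weight ?\<gamma> = m" "m = Suc ((n - 1) div 2)" using False wt n nm by linarith+
      show ?thesis
      proof (cases "even n")
        case True
        then have "?\<gamma> = string_power [False, True] (n div 2)"
          using 2 by (simp add: gamma_string_def)
        moreover have "take 2 (string_power [False, True] (n div 2)) = [False, True]"
          using True n by (cases "n div 2") auto
        ultimately have "period ?\<gamma> \<le> 2"
          unfolding period_def using len True by (intro Least_le) simp
        then show ?thesis using m(1) 2 i len unfolding cut_S_def binary_strings_def by auto
      next
        case False
        then have odd: "n + 1 = 2 * m" using m(2) n by presburger
        have "(n - 1) mod 2 = 0" "(n - 1) div 2 = m - 1" using odd by presburger+
        then have \<gamma>: "?\<gamma> = True # string_power [False, True] (m - 1)"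
          using gamma_string_eq[OF n, of 2] 2 by (simp add: block_def)
        have "rotate 1 ?\<gamma> = string_power [False, True] (m - 1) @ [True]"
          unfolding \<gamma> by simp
        then have "?\<gamma> \<in> \<Union> Cs"
          using alt[OF odd] pcr_cycle_rotate[of 1 ?\<gamma>] self_in_pcr_cycle[of ?\<gamma>] by auto
        then show ?thesis unfolding cut_S_def by blast
      qed
    qed
  next
    case 3
    have "(n - 1) div i \<le> (n - 1) div 3" using 3 by (intro div_le_mono2) auto
    \<comment> \<open>This bound is what makes \<open>1 + (n - 1) / 3\<close> smaller than
      \<open>n / 2\<close>.\<close>
    moreover have "5 \<le> n" using 3 i by simp
    ultimately have "Suc ((n - 1) div i) < m" using nm by linarith
    then show ?thesis using weight_gamma_string[OF n] 3 len by (intro S_low) auto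
  qed
qed

end

subsection \<open>Cutting out the segments\<close>

context weight_truncation
begin

lemma root_or_last_gamma_string:
  assumes "1 \<le> i"
  shows "gamma_string n i = root \<or> last (gamma_string n i)"
  using last_gamma_string[OF n_pos, of i] assms
  by (cases "i = 1") (auto simp: gamma_string_def)

text \<open>\<open>start\<close> ends in 1, so it could only occur where the weight is still that of
  \<open>gamma_string n i\<close>; but this is 0 for \<open>i = 1\<close> and at least 2
  otherwise.\<close>

lemma gamma_segment_avoids_start:
  assumes i: "1 \<le> i" "2 * i \<le> n + 1" and \<gamma>S: "gamma_string n i \<in> S" and k: "k < i"
  shows "(step ^^ k) (gamma_string n i) \<noteq> start"
proof
  assume eq: "(step ^^ k) (gamma_string n i) = start"
  have "weight start = 1" by simp
  then have "weight (gamma_string n i) = 1"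
    using gamma_segment(2)[OF i \<gamma>S k] unfolding eq by auto
  moreover have "weight (gamma_string n i) \<noteq> 1"
  proof (cases "i = 1")
    case False
    then have "2 \<le> i" "i \<le> n - 1" using i by linarith+
    then have "(n - 1) div i \<noteq> 0" by (simp add: div_eq_0_iff)
    then show ?thesis using weight_gamma_string[OF n_pos \<open>2 \<le> i\<close>] by simp
  qed (simp add: gamma_string_def)
  ultimately show False by blast
qed

text \<open>Toggling the last bit on arrival lands \<open>i\<close> steps further along the uncut
  cycle, which is the shortcut of \<open>is_cycle_cut\<close>.\<close>

lemma cut_one_segment:
  assumes i: "1 \<le> i" "2 * i \<le> n + 1" and \<gamma>S: "gamma_string n i \<in> S"
  defines "A \<equiv> S - (\<lambda>k. (step ^^ k) (gamma_string n i)) ` {..<i}"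
  shows "is_cycle (cut_step S {gamma_string n i}) start A" and "card A = card S - i"
proof -
  let ?\<gamma> = "gamma_string n i"
  have f: "cut_step S {?\<gamma>} x = (if step x = ?\<gamma> then (step ^^ i) ?\<gamma> else step x)" if "x \<in> S" for x
    using cut_step_eq[OF that, of "{?\<gamma>}"] \<gamma>S root_or_last_gamma_string[OF i(1)] gamma_segment(1)[OF i \<gamma>S]
    by auto
  note cut = is_cycle_cut[OF step_is_cycle \<gamma>S _ gamma_segment_avoids_start[OF i \<gamma>S] f]
  show "is_cycle (cut_step S {?\<gamma>}) start A" "card A = card S - i"
    unfolding A_def using cut i by auto
qed

text \<open>The segment of length \<open>j\<close> is cut first, then the one of length
  \<open>i\<close> from what remains. Weights keep them apart: the string for \<open>j\<close> has
  weight 2, the one for \<open>i\<close> weight 0 or at least 3.\<close>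

lemma cut_two_segments:
  assumes i: "1 \<le> i" "i < j" and j: "j = (n + 1) div 2"
    and \<gamma>S: "gamma_string n i \<in> S" "gamma_string n j \<in> S"
  shows "\<exists>A. is_cycle (cut_step S {gamma_string n j, gamma_string n i}) start A \<and> card A = card S - j - i"
proof -
  let ?\<gamma> = "gamma_string n j" and ?\<delta> = "gamma_string n i"
  define A where "A = S - (\<lambda>k. (step ^^ k) ?\<gamma>) ` {..<j}"
  have j': "1 \<le> j" "2 * j \<le> n + 1" "2 \<le> j" and i': "2 * i \<le> n + 1" using i j by auto
  have "(n - 1) div j = 1"
  proof -
    have "n \<le> 2 * j" using j by linarith
    then show ?thesis using j'(2,3) n_pos by (intro div_nat_eqI) auto
  qed
  then have w\<gamma>: "weight ?\<gamma> = 2" using weight_gamma_string[OF n_pos j'(3)] by simp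
  have l\<gamma>: "last ?\<gamma>" by (rule last_gamma_string[OF n_pos j'(3)])
  have \<delta>: "weight ?\<delta> = 0 \<and> ?\<delta> = root \<or> 3 \<le> weight ?\<delta> \<and> last ?\<delta>"
  proof (cases "i = 1")
    case False
    then have i2: "2 \<le> i" using i by simp
    \<comment> \<open>From \<open>i < j\<close> follows \<open>2 * i \<le> n - 1\<close>.\<close>
    have "2 \<le> (n - 1) div i" using i j i2 by (simp add: less_eq_div_iff_mult_less_eq)
    then show ?thesis using weight_gamma_string[OF n_pos i2] last_gamma_string[OF n_pos i2] by simp
  qed (simp add: gamma_string_def)
  have flip_\<gamma>: "weight (flip_last ?\<gamma>) = 1"
  proof -
    obtain v where "?\<gamma> = v @ [True]"
      using l\<gamma> S_length[OF \<gamma>S(2)] n_pos by (metis append_butlast_last_id list.size(3) not_one_le_zero)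
    then show ?thesis using w\<gamma> by simp
  qed
  have flip_\<delta>: "flip_last ?\<delta> \<noteq> ?\<gamma>"
  proof
    assume eq: "flip_last ?\<delta> = ?\<gamma>"
    show False
    proof (cases "?\<delta> = root")
      case True
      then have "weight (flip_last ?\<delta>) = 1" unfolding root_snoc by simp
      then show False using eq w\<gamma> by simp
    next
      case False
      then have "last ?\<delta>" using \<delta> by blast
      then have "\<not> last (flip_last ?\<delta>)" by (simp add: flip_last_def)
      then show False using eq l\<gamma> by simp
    qed
  qed
  \<comment> \<open>Along this segment strings have weight 2, or are nonzero and end in 0;
    \<open>?\<delta>\<close> is zero, or ends in 1 with weight at least 3.\<close>
  have \<gamma>\<delta>: "(step ^^ k) ?\<gamma> \<noteq> ?\<delta>" if "k < j" for k
    using gamma_segment(2)[OF j'(1,2) \<gamma>S(2) that] w\<gamma> \<delta> by auto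
  have \<delta>\<gamma>: "(step ^^ k) ?\<delta> \<noteq> ?\<gamma>" if "k < i" for k
    using gamma_segment(2)[OF i(1) i' \<gamma>S(1) that] w\<gamma> l\<gamma> \<delta> by auto
  let ?f = "cut_step S {?\<gamma>}"
  have f: "?f x = (if step x = ?\<gamma> then flip_last ?\<gamma> else step x)" if "x \<in> S" for x
    using cut_step_eq[OF that, of "{?\<gamma>}"] \<gamma>S(2) l\<gamma> by auto
  have cyc: "is_cycle ?f start A" and cardA: "card A = card S - j"
    unfolding A_def by (rule cut_one_segment[OF j'(1,2) \<gamma>S(2)])+
  have \<delta>A: "?\<delta> \<in> A" unfolding A_def using \<gamma>S(1) \<gamma>\<delta> by force
  have inS: "(step ^^ k) ?\<delta> \<in> S" for k
    by (induction k) (use \<gamma>S(1) step_in_S in auto)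
  \<comment> \<open>Along the second segment, its end included, no step arrives at
    \<open>?\<gamma>\<close>, so the first cut leaves it untouched.\<close>
  have f\<delta>: "(?f ^^ k) ?\<delta> = (step ^^ k) ?\<delta>" if "k \<le> i" for k
    using that
  proof (induction k)
    case (Suc k)
    have "(step ^^ Suc k) ?\<delta> \<noteq> ?\<gamma>"
    proof (cases "Suc k = i")
      case True
      then show ?thesis using gamma_segment(1)[OF i(1) i' \<gamma>S(1)] flip_\<delta> by metis
    next
      case False
      then show ?thesis using \<delta>\<gamma>[of "Suc k"] Suc.prems by simp
    qed
    then show ?case using f[OF inS[of k]] Suc by simp
  qed simp
  \<comment> \<open>The jump of the first cut lands on a string of weight 1, never on
    \<open>?\<delta>\<close>. Testing both strings at once therefore amounts to a second cut of the
    map already cut once.\<close>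
  have F: "cut_step S {?\<gamma>, ?\<delta>} x = (if ?f x = ?\<delta> then (?f ^^ i) ?\<delta> else ?f x)" if "x \<in> A" for x
  proof -
    have x: "x \<in> S" using that unfolding A_def by blast
    have "cut_step S {?\<gamma>, ?\<delta>} x
      = (if step x \<in> {?\<gamma>, ?\<delta>} then flip_last (step x) else step x)"
      by (rule cut_step_eq[OF x]) (use \<gamma>S l\<gamma> \<delta> in auto)
    moreover have "flip_last ?\<gamma> \<noteq> ?\<delta>" using flip_\<gamma> \<delta> by auto
    moreover have "?\<gamma> \<noteq> ?\<delta>" using \<gamma>\<delta>[of 0] j' by simp
    moreover have "(?f ^^ i) ?\<delta> = flip_last ?\<delta>"
      using f\<delta>[of i] gamma_segment(1)[OF i(1) i' \<gamma>S(1)] by simp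
    ultimately show ?thesis using f[OF x] by auto
  qed
  have avoid: "(?f ^^ k) ?\<delta> \<noteq> start" if "k < i" for k
    using f\<delta>[of k] gamma_segment_avoids_start[OF i(1) i' \<gamma>S(1) that] that by simp
  have "0 < i" using i by simp
  note cut = is_cycle_cut[OF cyc \<delta>A this avoid F]
  show ?thesis using cut cardA by metis
qed

end

section \<open>From a cycle of states to a cut-down de Bruijn sequence\<close>

lemma cut_step_eq_tl_snoc: "\<exists>b. cut_step S R \<alpha> = tl \<alpha> @ [b]"
  by (simp add: cut_step_def Let_def)

text \<open>As \<open>f\<close> shifts by one symbol, each state consists of the first symbols of
  the \<open>n\<close> states starting with it; distinct states on the cycle thus give distinct
  windows.\<close>

lemma cutdown_de_bruijn_of_cycle:
  assumes n: "1 \<le> n" and cyc: "is_cycle f z A" and L: "card A = L" and z: "length z = n"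
    and shift: "\<And>x. \<exists>b. f x = tl x @ [b]"
  shows "cutdown_de_bruijn n L (map (\<lambda>i. hd ((f ^^ i) z)) [0..<L])"
proof -
  let ?a = "\<lambda>i. (f ^^ i) z"
  let ?u = "map (\<lambda>i. hd (?a i)) [0..<L]"
  have len: "length (?a i) = n" for i
  proof (induction i)
    case (Suc i)
    obtain b where "f (?a i) = tl (?a i) @ [b]" using shift by blast
    then show ?case using Suc n by simp
  qed (simp add: z)
  have nth: "?a i ! k = hd (?a (i + k))" if "k < n" for i k
    using that
  proof (induction k arbitrary: i)
    case 0
    then have "?a i \<noteq> []" using len[of i] n by auto
    then show ?case by (simp add: hd_conv_nth)
  next
    case (Suc k)
    have "k < n - 1" using Suc.prems by simp
    moreover obtain b where "f (?a i) = tl (?a i) @ [b]" using shift by blast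
    ultimately have "?a (Suc i) ! k = ?a i ! Suc k"
      using len[of i] by (simp add: nth_append nth_tl)
    then show ?case using Suc.IH[of "Suc i"] Suc.prems by simp
  qed
  have "(f ^^ L) z = z" using cyc L unfolding is_cycle_def by blast
  \<comment> \<open>Returning after \<open>L\<close> steps turns the cyclic index of a window into
    plain iteration, so windows that wrap around are covered.\<close>
  then have mod: "?a (i mod L) = ?a i" for i by (rule funpow_mod_eq)
  have inj: "inj_on ?a {..<L}" using is_cycle_inj[OF cyc] L by simp
  have win: "cyclic_window n ?u i = ?a i" if "i < L" for i
  proof (rule nth_equalityI)
    show "length (cyclic_window n ?u i) = length (?a i)" by (simp add: cyclic_window_def len)
  next
    fix k assume "k < length (cyclic_window n ?u i)"
    then have k: "k < n" by (simp add: cyclic_window_def)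
    have "(i + k) mod L < L" using that by simp
    then have "cyclic_window n ?u i ! k = hd (?a ((i + k) mod L))"
      using k by (simp add: cyclic_window_def)
    then show "cyclic_window n ?u i ! k = ?a i ! k" using mod[of "i + k"] nth[OF k] by simp
  qed
  have "card {i. i < L \<and> cyclic_window n ?u i = w} \<le> 1" for w
  proof -
    let ?I = "{i. i < L \<and> cyclic_window n ?u i = w}"
    have fin: "finite ?I" by simp
    have "i = k" if "i \<in> ?I" "k \<in> ?I" for i k
      using that win[of i] win[of k] inj_onD[OF inj, of i k] by simp
    then show ?thesis unfolding One_nat_def card_le_Suc0_iff_eq[OF fin] by blast
  qed
  then show ?thesis unfolding cutdown_de_bruijn_def by simp
qed

theorem theorem1:
  fixes n L m h t s :: nat
    and Cs :: "bool list set set"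
    and T S R :: "bool list set"
    and a :: "nat \<Rightarrow> bool list"
  assumes "n \<ge> 1" and "2 ^ (n - 1) < L" and "L \<le> 2 ^ n"
    and "m = cut_m n L" and "h = cut_h n L" and "t = cut_t n L" and "s = cut_s n L"
    and "Cs \<subseteq> {pcr_cycle \<alpha> | \<alpha>. \<alpha> \<in> binary_strings n \<and> weight \<alpha> = m \<and> period \<alpha> = h}"
    and "card Cs = t"
    and "T = \<Union> Cs"
    and "n + 1 = 2 * m \<Longrightarrow> pcr_cycle (string_power [False, True] (m - 1) @ [True]) \<subseteq> T"
    and "S = cut_S n m h T"
    and "R = cut_R n s"
    and "\<And>i. a i = (cut_step S R ^^ i) (replicate (n - 1) False @ [True])"
  shows "a L = a 0 \<and> cutdown_de_bruijn n L (map (\<lambda>i. hd (a i)) [0..<L])"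
proof -
  note par = cut_parameters[OF assms(1-7)]
  interpret cut_set n m h t Cs
    using par assms(1,8,9) by unfold_locales auto
  have S: "S = cut_S n m h (\<Union> Cs)" using assms(10,12) by simp
  have card: "card S = L + s" unfolding S card_cut_S using par(6) .
  have \<gamma>S: "gamma_string n i \<in> S" if "1 \<le> i" "2 * i \<le> n + 1" "i < h" for i
    unfolding S using gamma_string_in_S[OF that] assms(10,11) by blast
  let ?z = "replicate (n - 1) False @ [True]"
  define j where "j = (n + 1) div 2"
  have "\<exists>A. is_cycle (cut_step S R) ?z A \<and> card A = L"
  proof -
    consider "s = 0" | "1 \<le> s" "s \<le> j" | "j < s" by linarith
    then show ?thesis
    proof cases
      case 1
      then have "R = {}" using assms(13) by (simp add: cut_R_def)
      then show ?thesis using step_is_cycle card 1 S by auto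
    next
      case 2
      then have "R = {gamma_string n s}" using assms(13) by (simp add: cut_R_def j_def)
      moreover have "2 * s \<le> n + 1" using 2 j_def by simp
      ultimately show ?thesis
        using cut_one_segment[OF 2(1), folded S] \<gamma>S[of s] par(5) card 2 by auto
    next
      case 3
      define i where "i = s - j"
      \<comment> \<open>\<open>s < h \<le> n\<close> and \<open>j\<close> is half of
        \<open>n\<close> rounded up, so the remaining length \<open>s - j\<close> is less than
        \<open>j\<close>; moreover \<open>j < s < h\<close>.\<close>
      have i: "1 \<le> i" "i < j" "2 * i \<le> n + 1" "i < h" and j: "1 \<le> j" "2 * j \<le> n + 1" "j < h"
        using 3 par(3,5) assms(1) by (auto simp: i_def j_def)
      have "R = {gamma_string n j, gamma_string n i}"
        using assms(13) 3 by (simp add: cut_R_def j_def i_def Let_def)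
      then show ?thesis
        using cut_two_segments[OF i(1,2) j_def, folded S] \<gamma>S[OF i(1,3,4)] \<gamma>S[OF j] card 3
        by (auto simp: i_def)
    qed
  qed
  then obtain A where A: "is_cycle (cut_step S R) ?z A" "card A = L" by blast
  have "a L = a 0" unfolding assms(14) using A unfolding is_cycle_def by simp
  moreover have "cutdown_de_bruijn n L (map (\<lambda>i. hd (a i)) [0..<L])"
    unfolding assms(14) using cutdown_de_bruijn_of_cycle[OF assms(1) A _ cut_step_eq_tl_snoc] assms(1) by simp
  ultimately show ?thesis by blast
qed

end
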